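(* Let $F_2(x)=\sum_{n=1}^\infty \frac{\sigma_1(n)}{n^3}\sin(2\pi n x)$ and $G_2(x)=\sum_{n=1}^\infty \frac{\sigma_1(n)}{n^3}\cos(2\pi n x)$ for $x\in\mathbb{R}$. (i) If $x\in\mathbb{R}\setminus\mathbb{Q}$ is a square-Brjuno number which satisfies condition $(\ast)$ or condition $(\ast\ast)$, then $F_2$ is differentiable at $x$. On the other hand, if $x\in\mathbb{R}\setminus\mathbb{Q}$ is not a square-Brjuno number, then $F_2$ is not differentiable at $x$. (ii) If $x\in\mathbb{R}\setminus\mathbb{Q}$ satisfies condition $(\ast)$ or condition $(\ast\ast)$, then $G_2$ is differentiable at $x$.
   Context: $\sigma_1(n)=\sum_{d\mid n}d$. For irrational $x$ write its continued fraction expansion $x=[a_0(x);a_1(x),a_2(x),\dots]$ with partial quotients $a_i(x)$, and let $p_n(x)/q_n(x)=[a_0;a_1,\dots,a_n]$ be its convergents, given by $p_n=a_np_{n-1}+p_{n-2}$, $q_n=a_nq_{n-1}+q_{n-2}$ for $n\ge 0$ with $p_{-1}=1,p_{-2}=0,q_{-1}=0,q_{-2}=1$ (so $q_0=1$). An irrational $x$ is called square-Brjuno if $\sum_{n=0}^\infty \frac{\log q_{n+1}(x)}{q_n(x)^2}<\infty$. Condition $(\ast)$: $\lim_{n\to\infty}\frac{\log q_{n+4}(x)}{q_n(x)^2}=0$. Condition $(\ast\ast)$: $\lim_{n\to\infty}\frac{\log q_{n+3}(x)}{q_n(x)^2}=0$ and $a_n(x)=1$ for only finitely many $n$. *)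

theory Defs
  imports "HOL-Analysis.Analysis"
begin

definition sigma1 :: "nat \<Rightarrow> nat" where
  "sigma1 n = (\<Sum>d | d dvd n. d)"

text \<open>
  Complete quotients of the continued fraction algorithm.  For rational \<open>x\<close> the algorithm
  terminates, and from then on the values below are junk (\<open>1 / 0 = 0\<close>); everything that uses
  them is only meaningful for irrational \<open>x\<close>.
\<close>

primrec complete_quotient :: "real \<Rightarrow> nat \<Rightarrow> real" where
  "complete_quotient x 0 = x"
| "complete_quotient x (Suc n) = 1 / frac (complete_quotient x n)"

definition partial_quotient :: "real \<Rightarrow> nat \<Rightarrow> int" where
  "partial_quotient x n = \<lfloor>complete_quotient x n\<rfloor>"

text \<open>
  Denominators \<open>q\<^sub>n\<close> of the convergents: the recurrence \<open>q\<^sub>n = a\<^sub>n q\<^sub>n\<^sub>-\<^sub>1 + q\<^sub>n\<^sub>-\<^sub>2\<close> for \<open>n \<ge> 0\<close>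
  with \<open>q\<^sub>-\<^sub>1 = 0\<close> and \<open>q\<^sub>-\<^sub>2 = 1\<close>, where the two negative indices have been eliminated:
  they give \<open>q\<^sub>0 = 1\<close> and \<open>q\<^sub>1 = a\<^sub>1\<close>.
\<close>

fun conv_denom :: "real \<Rightarrow> nat \<Rightarrow> int" where
  "conv_denom x 0 = 1"
| "conv_denom x (Suc 0) = partial_quotient x 1"
| "conv_denom x (Suc (Suc n)) =
     partial_quotient x (Suc (Suc n)) * conv_denom x (Suc n) + conv_denom x n"

text \<open>
  The terms of the series are nonnegative for irrational \<open>x\<close> (as \<open>q\<^sub>n \<ge> 1\<close>), so finiteness of
  the sum is summability.
\<close>

definition square_brjuno :: "real \<Rightarrow> bool" where
  "square_brjuno x \<longleftrightarrow> x \<notin> \<rat> \<and>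
     summable (\<lambda>n. ln (real_of_int (conv_denom x (n + 1))) / (real_of_int (conv_denom x n))\<^sup>2)"

definition cond_star :: "real \<Rightarrow> bool" where
  "cond_star x \<longleftrightarrow>
     (\<lambda>n. ln (real_of_int (conv_denom x (n + 4))) / (real_of_int (conv_denom x n))\<^sup>2)
       \<longlonglongrightarrow> 0"

definition cond_star_star :: "real \<Rightarrow> bool" where
  "cond_star_star x \<longleftrightarrow>
     ((\<lambda>n. ln (real_of_int (conv_denom x (n + 3))) / (real_of_int (conv_denom x n))\<^sup>2)
       \<longlonglongrightarrow> 0) \<and>
     finite {n. partial_quotient x n = 1}"

text \<open>
  The series start at \<open>n = 1\<close>, hence the index shift.  They converge absolutely for every real
  \<open>x\<close>, because \<open>sigma1 n \<le> n (1 + ln n)\<close>.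
\<close>

definition F2 :: "real \<Rightarrow> real" where
  "F2 x = (\<Sum>n. real (sigma1 (Suc n)) / real (Suc n) ^ 3 * sin (2 * pi * real (Suc n) * x))"

definition G2 :: "real \<Rightarrow> real" where
  "G2 x = (\<Sum>n. real (sigma1 (Suc n)) / real (Suc n) ^ 3 * cos (2 * pi * real (Suc n) * x))"

end

theory Submission
  imports Defs
begin

text \<open>
  Since \<open>\<sigma>\<^sub>1(n) / n\<^sup>3\<close> is the sum of \<open>1 / (m\<^sup>3 d\<^sup>2)\<close> over all factorisations \<open>n = m d\<close>, the functions
  \<open>F\<^sub>2(x)\<close> and \<open>G\<^sub>2(x)\<close> are the imaginary and the real part of \<open>\<Sum>\<^sub>m m\<^sup>-\<^sup>3 Z(m x)\<close>, where
  \<open>Z(t)\<close> is the dilogarithm at \<open>exp(2 \<pi> i t)\<close>.  Off the integers \<open>Z\<close> has derivative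
  \<open>-2 \<pi> i Ln(1 - exp(2 \<pi> i t))\<close>.  Its real part is bounded, so the series for \<open>G\<^sub>2\<close> can be
  differentiated termwise at every irrational point.  Its imaginary part behaves like
  \<open>-2 \<pi> ln \<parallel>t\<parallel>\<close>, where \<open>\<parallel>t\<parallel>\<close> is the distance to the nearest integer, and dominates the difference
  quotients of \<open>Im Z\<close> at \<open>t\<close> up to an additive constant, whatever the increment; these quotients are
  also bounded below.  By dominated convergence and Fatou's lemma \<open>F\<^sub>2\<close> is therefore differentiable
  at an irrational \<open>x\<close> exactly if \<open>\<Sum>\<^sub>m m\<^sup>-\<^sup>2 ln (1 / \<parallel>m x\<parallel>)\<close> converges.  In that sum only the \<open>m\<close>
  with \<open>\<parallel>m x\<parallel> < 1 / (4 m)\<close> matter; they are multiples of denominators \<open>q\<^sub>n\<close> of convergents, and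
  \<open>\<parallel>q\<^sub>n x\<parallel>\<close> is comparable to \<open>1 / q\<^sub>n\<^sub>+\<^sub>1\<close>, which turns it into the square-Brjuno sum.
\<close>

subsection \<open>Convergents\<close>

text \<open>Numerators of the convergents, where \<open>p\<^sub>-\<^sub>1 = 1\<close> and
  \<open>p\<^sub>-\<^sub>2 = 0\<close> are eliminated in the same way as for
  \<open>conv_denom\<close>.\<close>

fun conv_num :: "real \<Rightarrow> nat \<Rightarrow> int" where
  "conv_num x 0 = partial_quotient x 0"
| "conv_num x (Suc 0) = partial_quotient x 1 * partial_quotient x 0 + 1"
| "conv_num x (Suc (Suc n)) =
     partial_quotient x (Suc (Suc n)) * conv_num x (Suc n) + conv_num x n"

lemma complete_quotient_irrational:
  assumes "x \<notin> \<rat>"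
  shows "complete_quotient x n \<notin> \<rat>"
proof (induction n)
  case (Suc n)
  have "1 / (1 / frac (complete_quotient x n)) \<notin> \<rat>"
    using Suc by (simp add: frac_in_Rats_iff)
  then show ?case by (metis Rats_1 Rats_divide complete_quotient.simps(2))
qed (use assms in simp)

lemma complete_quotient_frac_pos:
  assumes "x \<notin> \<rat>"
  shows "frac (complete_quotient x n) > 0"
  using complete_quotient_irrational[OF assms, of n] Ints_subset_Rats
  by (metis frac_gt_0_iff subsetD)

lemma complete_quotient_Suc_gt_1:
  assumes "x \<notin> \<rat>"
  shows "complete_quotient x (Suc n) > 1"
  using complete_quotient_frac_pos[OF assms, of n] frac_lt_1[of "complete_quotient x n"]
  by simp

lemma complete_quotient_rec:
  "complete_quotient x n = partial_quotient x n + 1 / complete_quotient x (Suc n)"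
  by (simp add: partial_quotient_def frac_def)

lemma partial_quotient_bounds:
  "of_int (partial_quotient x n) \<le> complete_quotient x n"
  "complete_quotient x n < of_int (partial_quotient x n) + 1"
  by (simp_all add: partial_quotient_def)

lemma partial_quotient_Suc_ge_1:
  assumes "x \<notin> \<rat>"
  shows "partial_quotient x (Suc n) \<ge> 1"
  using complete_quotient_Suc_gt_1[OF assms, of n] by (simp add: partial_quotient_def)

lemma conv_denom_ge_1:
  assumes "x \<notin> \<rat>"
  shows "conv_denom x n \<ge> 1 \<and> conv_denom x (Suc n) \<ge> 1"
proof (induction n)
  case 0
  then show ?case using partial_quotient_Suc_ge_1[OF assms, of 0] by simp
next
  case (Suc n)
  then have "partial_quotient x (Suc (Suc n)) * conv_denom x (Suc n) \<ge> 1"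
    using mult_mono[of 1 "partial_quotient x (Suc (Suc n))" 1 "conv_denom x (Suc n)"]
      partial_quotient_Suc_ge_1[OF assms, of "Suc n"] by simp
  then show ?case using Suc by simp
qed

text \<open>Strictness starts at index 1: the denominators at 0 and 1 are equal when the first
  partial quotient after the integer part is 1.\<close>

lemma conv_denom_less:
  assumes "x \<notin> \<rat>"
  shows "conv_denom x (Suc n) < conv_denom x (Suc (Suc n))"
proof -
  have "1 * conv_denom x (Suc n) \<le> partial_quotient x (Suc (Suc n)) * conv_denom x (Suc n)"
    using conv_denom_ge_1[OF assms, of n] partial_quotient_Suc_ge_1[OF assms, of "Suc n"]
    by (intro mult_right_mono) auto
  then show ?thesis
    unfolding conv_denom.simps using conv_denom_ge_1[OF assms, of n] by linarith
qed

lemma conv_denom_le_Suc: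
  assumes "x \<notin> \<rat>"
  shows "conv_denom x n \<le> conv_denom x (Suc n)"
  using conv_denom_less[OF assms] conv_denom_ge_1[OF assms, of 0]
  by (cases n) (auto intro: less_imp_le)

lemma conv_denom_Suc_ge:
  assumes "x \<notin> \<rat>"
  shows "int (Suc n) \<le> conv_denom x (Suc n)"
proof (induction n)
  case 0
  then show ?case using conv_denom_ge_1[OF assms, of 0] by simp
next
  case (Suc n)
  then show ?case using conv_denom_less[OF assms, of n] by linarith
qed

text \<open>One step of the two recurrences flips the sign of this determinant.\<close>

lemma conv_det:
  "conv_num x (Suc n) * conv_denom x n - conv_num x n * conv_denom x (Suc n) = (-1) ^ n"
  by (induction n) (auto simp: algebra_simps)

lemma coprime_conv: "coprime (conv_denom x n) (conv_num x n)"
proof (rule coprimeI)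
  fix c assume "c dvd conv_denom x n" "c dvd conv_num x n"
  then have "c dvd conv_num x (Suc n) * conv_denom x n - conv_num x n * conv_denom x (Suc n)"
    by auto
  then have "c dvd (-1) ^ n" by (simp only: conv_det)
  moreover have "((-1) ^ n :: int) dvd 1" by (cases "even n") auto
  ultimately show "is_unit c" by (rule dvd_trans)
qed

definition conv_error :: "real \<Rightarrow> nat \<Rightarrow> real" where
  "conv_error x n = real_of_int (conv_denom x n) * x - real_of_int (conv_num x n)"

text \<open>The errors obey the same recurrence as numerators and denominators. Writing the partial
  quotient as \<open>X2 - 1 / X3\<close> cancels everything except the term with
  \<open>X3\<close>.\<close>

lemma conv_error_rec:
  assumes "x \<notin> \<rat>"
  shows "complete_quotient x (Suc (Suc n)) * conv_error x (Suc n) = - conv_error x n"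
proof (induction n)
  case 0
  define X1 where "X1 = complete_quotient x (Suc 0)"
  define X2 where "X2 = complete_quotient x (Suc (Suc 0))"
  have pos: "X1 > 1" "X2 > 1"
    unfolding X1_def X2_def by (rule complete_quotient_Suc_gt_1[OF assms])+
  have x: "x = partial_quotient x 0 + 1 / X1"
    using complete_quotient_rec[of x 0] by (simp only: X1_def complete_quotient.simps(1))
  have X1: "X1 = partial_quotient x (Suc 0) + 1 / X2"
    using complete_quotient_rec[of x "Suc 0"] by (simp only: X1_def X2_def)
  have e0: "conv_error x 0 = 1 / X1"
    using x by (simp add: conv_error_def)
  have "conv_error x (Suc 0) = partial_quotient x (Suc 0) * (x - partial_quotient x 0) - 1"
    by (simp add: conv_error_def algebra_simps)
  also have "\<dots> = (X1 - 1 / X2) * (1 / X1) - 1"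
    using x X1 by (metis add_diff_cancel_left' add_diff_cancel_right')
  also have "\<dots> = - (1 / X1) / X2" using pos by (simp add: field_simps)
  finally show ?case using pos by (simp only: e0 flip: X2_def) (simp add: field_simps)
next
  case (Suc n)
  define X2 where "X2 = complete_quotient x (Suc (Suc n))"
  define X3 where "X3 = complete_quotient x (Suc (Suc (Suc n)))"
  have pos: "X3 > 1" unfolding X3_def by (rule complete_quotient_Suc_gt_1[OF assms])
  have X2: "X2 = partial_quotient x (Suc (Suc n)) + 1 / X3"
    using complete_quotient_rec[of x "Suc (Suc n)"] by (simp only: X2_def X3_def)
  have "conv_error x (Suc (Suc n)) =
      partial_quotient x (Suc (Suc n)) * conv_error x (Suc n) + conv_error x n"
    by (simp add: conv_error_def algebra_simps)
  also have "conv_error x n = - (X2 * conv_error x (Suc n))" using Suc by (simp only: X2_def)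
  finally have "conv_error x (Suc (Suc n)) = - (conv_error x (Suc n) / X3)"
    by (simp add: X2 algebra_simps)
  then show ?case using pos by (simp only: flip: X3_def) simp
qed

text \<open>The error is exactly \<open>1 / D\<close>, where \<open>D\<close> arises from the
  recurrence for the next denominator by putting the complete quotient for the partial one. Hence
  \<open>D\<close> exceeds that denominator by at most the preceding one.\<close>

lemma conv_error_bounds:
  assumes "x \<notin> \<rat>"
  shows "\<bar>conv_error x n\<bar> \<le> 1 / conv_denom x (Suc n)"
    and "1 / (2 * conv_denom x (Suc n)) \<le> \<bar>conv_error x n\<bar>"
proof -
  have "\<exists>D::real. \<bar>conv_error x n\<bar> = 1 / D \<and>
      conv_denom x (Suc n) \<le> D \<and> D \<le> 2 * conv_denom x (Suc n)"
  proof (cases n)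
    case 0
    have "conv_error x 0 = 1 / complete_quotient x (Suc 0)"
      using complete_quotient_rec[of x 0] by (simp add: conv_error_def)
    moreover have "real_of_int (partial_quotient x (Suc 0)) \<ge> 1"
      using partial_quotient_Suc_ge_1[OF assms, of 0] by simp
    moreover have "conv_denom x (Suc 0) = partial_quotient x (Suc 0)" by simp
    ultimately show ?thesis
      unfolding 0 using partial_quotient_bounds[of x "Suc 0"]
      by (intro exI[of _ "complete_quotient x (Suc 0)"] conjI)
         (simp_all del: complete_quotient.simps)
  next
    case (Suc k)
    define X where "X = complete_quotient x (Suc (Suc k))"
    define D where "D = conv_denom x k + X * conv_denom x (Suc k)"
    have X: "X > 1" "of_int (partial_quotient x (Suc (Suc k))) \<le> X"
        "X \<le> of_int (partial_quotient x (Suc (Suc k))) + 1"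
      using complete_quotient_Suc_gt_1[OF assms, of "Suc k"]
        partial_quotient_bounds[of x "Suc (Suc k)"] by (auto simp only: X_def)
    have q: "real_of_int (conv_denom x (Suc k)) \<ge> 1" "real_of_int (conv_denom x k) \<ge> 1"
      using conv_denom_ge_1[OF assms, of k] by auto
    \<comment> \<open>The multiples of \<open>x\<close> cancel and leave the determinant;
      eliminating \<open>conv_error x k\<close> then produces \<open>D\<close>.\<close>
    have "conv_error x (Suc k) * conv_denom x k - conv_error x k * conv_denom x (Suc k) =
        - of_int (conv_num x (Suc k) * conv_denom x k - conv_num x k * conv_denom x (Suc k))"
      by (simp add: conv_error_def algebra_simps)
    also have "\<dots> = - ((-1) ^ k)" by (simp only: conv_det) simp
    also have "conv_error x k = - (X * conv_error x (Suc k))"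
      using conv_error_rec[OF assms, of k] by (simp only: X_def)
    finally have "conv_error x (Suc k) * D = - ((-1) ^ k)"
      by (simp add: D_def algebra_simps)
    then have "\<bar>conv_error x (Suc k)\<bar> * \<bar>D\<bar> = 1" by (simp flip: abs_mult)
    moreover have lo: "conv_denom x (Suc (Suc k)) \<le> D"
      using X q mult_right_mono[OF X(2), of "conv_denom x (Suc k)"] by (simp add: D_def)
    moreover have "D \<le> conv_denom x (Suc (Suc k)) + conv_denom x (Suc k)"
      using X q mult_right_mono[OF X(3), of "conv_denom x (Suc k)"]
      by (simp add: D_def algebra_simps)
    moreover have "real_of_int (conv_denom x (Suc k)) \<le> conv_denom x (Suc (Suc k))"
      using conv_denom_le_Suc[OF assms, of "Suc k"] by linarith
    moreover have "D > 0"
      using lo conv_denom_ge_1[OF assms, of "Suc k"] by linarith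
    ultimately show ?thesis
      unfolding Suc by (intro exI[of _ D]) (auto simp: field_simps simp del: conv_denom.simps)
  qed
  then obtain D :: real where D: "\<bar>conv_error x n\<bar> = 1 / D" "conv_denom x (Suc n) \<le> D"
      "D \<le> 2 * conv_denom x (Suc n)" by auto
  have "real_of_int (conv_denom x (Suc n)) \<ge> 1" using conv_denom_ge_1[OF assms, of n] by simp
  with D show "\<bar>conv_error x n\<bar> \<le> 1 / conv_denom x (Suc n)"
    and "1 / (2 * conv_denom x (Suc n)) \<le> \<bar>conv_error x n\<bar>"
    by (simp_all add: frac_le)
qed

subsection \<open>Brjuno sums and the distance to the nearest integer\<close>

definition int_dist :: "real \<Rightarrow> real" where
  "int_dist y = \<bar>y - of_int (round y)\<bar>"

lemma int_dist_le: "int_dist y \<le> \<bar>y - of_int m\<bar>"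
  unfolding int_dist_def by (rule round_diff_minimal)

lemma int_dist_le_half: "int_dist y \<le> 1 / 2"
  using of_int_round_abs_le[of y] by (simp add: int_dist_def abs_minus_commute)

lemma int_dist_pos:
  assumes "y \<notin> \<int>"
  shows "int_dist y > 0"
  using assms unfolding int_dist_def by (metis Ints_of_int eq_iff_diff_eq_0 zero_less_abs_iff)

lemma of_nat_mult_irrational:
  fixes x :: real
  assumes "x \<notin> \<rat>" "m > 0"
  shows "real m * x \<notin> \<int>"
proof
  assume "real m * x \<in> \<int>"
  then have "real m * x / real m \<in> \<rat>" using Ints_subset_Rats by (intro Rats_divide) auto
  with assms show False by simp
qed

text \<open>Integers are covered by the default value \<open>ln 0 = 0\<close>.\<close>

lemma neg_ln_int_dist_nonneg: "- ln (int_dist y) \<ge> 0"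
proof (cases "int_dist y = 0")
  case False
  then have "int_dist y > 0" by (simp add: int_dist_def)
  then show ?thesis using int_dist_le_half[of y] by (simp add: ln_le_zero_iff)
qed simp

lemma brjuno_term_nonneg:
  assumes "x \<notin> \<rat>"
  shows "ln (real_of_int (conv_denom x (n + 1))) / (real_of_int (conv_denom x n))\<^sup>2 \<ge> 0"
  using conv_denom_ge_1[OF assms, of n] by (simp add: ln_ge_zero)

text \<open>Only the terms whose dilation factor is a denominator are kept. At such a factor the
  distance to the integers is at most the reciprocal of the next denominator.\<close>

lemma square_brjuno_if_summable:
  assumes "x \<notin> \<rat>"
    and "summable (\<lambda>m. - ln (int_dist (real (Suc m) * x)) / (real (Suc m))\<^sup>2)"
  shows "square_brjuno x"
proof -
  define g where "g m = - ln (int_dist (real (Suc m) * x)) / (real (Suc m))\<^sup>2" for m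
  define b where
    "b n = ln (real_of_int (conv_denom x (n + 1))) / (real_of_int (conv_denom x n))\<^sup>2" for n
  \<comment> \<open>Position of a denominator in the series that starts at factor 1. Beginning with
    denominator 1 makes \<open>j\<close> injective; the omitted Brjuno term does not affect
    summability.\<close>
  define j where "j n = nat (conv_denom x (Suc n)) - 1" for n
  have q: "conv_denom x (Suc n) \<ge> 1" for n using conv_denom_ge_1[OF assms(1)] by blast
  have Suc_j: "real (Suc (j n)) = conv_denom x (Suc n)" for n
    using q[of n] unfolding j_def by (metis Suc_diff_1 of_nat_nat order_trans zero_le_one
        of_int_of_nat_eq zero_less_nat_eq zero_less_one_class.zero_less_one less_le_trans)
  have "strict_mono (\<lambda>n. conv_denom x (Suc n))"
    using conv_denom_less[OF assms(1)] by (simp add: strict_mono_Suc_iff)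
  then have "inj (\<lambda>n. real_of_int (conv_denom x (Suc n)))"
    by (meson inj_def of_int_eq_iff strict_mono_eq)
  then have "inj j" unfolding inj_def by (metis Suc_j)
  then have "summable (g \<circ> j)"
    using assms(2) neg_ln_int_dist_nonneg
    by (intro summable_reindex) (auto simp: g_def[abs_def] simp del: of_nat_Suc intro!: divide_nonpos_nonneg)
  moreover have "norm (ln (real_of_int (conv_denom x (Suc n + 1))) /
        (real_of_int (conv_denom x (Suc n)))\<^sup>2)
      \<le> (g \<circ> j) n" for n
  proof -
    have "int_dist (conv_denom x (Suc n) * x) \<le> \<bar>conv_error x (Suc n)\<bar>"
      unfolding conv_error_def by (rule int_dist_le)
    also have "\<dots> \<le> 1 / conv_denom x (Suc (Suc n))"
      by (rule conv_error_bounds[OF assms(1)])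
    finally have le: "int_dist (conv_denom x (Suc n) * x) \<le> 1 / conv_denom x (Suc (Suc n))" .
    have "int_dist (real (Suc (j n)) * x) > 0"
      using of_nat_mult_irrational[OF assms(1), of "Suc (j n)"] by (intro int_dist_pos) simp
    then have "ln (int_dist (conv_denom x (Suc n) * x)) \<le> ln (1 / conv_denom x (Suc (Suc n)))"
      using le q[of "Suc n"] unfolding Suc_j
      by (subst ln_le_cancel_iff) (auto simp del: conv_denom.simps)
    also have "\<dots> = - ln (conv_denom x (Suc (Suc n)))"
      using q[of "Suc n"] by (subst ln_div) (auto simp del: conv_denom.simps)
    finally have "ln (conv_denom x (Suc (Suc n))) / (real_of_int (conv_denom x (Suc n)))\<^sup>2
        \<le> (- ln (int_dist (conv_denom x (Suc n) * x))) / (real_of_int (conv_denom x (Suc n)))\<^sup>2"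
      by (intro divide_right_mono) auto
    then show ?thesis
      using brjuno_term_nonneg[OF assms(1), of "Suc n"] by (simp add: g_def Suc_j[simplified])
  qed
  ultimately have "summable (\<lambda>n. b (Suc n))"
    unfolding b_def by (rule summable_comparison_test')
  then have "summable b" by (simp only: summable_Suc_iff)
  with assms(1) show ?thesis by (simp add: square_brjuno_def b_def[abs_def])
qed

text \<open>
  A weak form of Legendre's theorem: with \<open>n\<close> minimal such that \<open>2 * m \<le> q\<^sub>n\<^sub>+\<^sub>1\<close>, the integer
  \<open>p * q\<^sub>n - m * p\<^sub>n\<close> has absolute value less than \<open>1\<close>.
\<close>
lemma near_integer_multiple_of_convergent:
  assumes "x \<notin> \<rat>" "m > 0" "int_dist (real m * x) < 1 / (4 * real m)"
  shows "\<exists>n k. k > 0 \<and> int m = int k * conv_denom x n \<and>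
    - ln (int_dist (real m * x)) \<le> ln (2 * real_of_int (conv_denom x (Suc n)))"
proof -
  define p where "p = round (real m * x)"
  define P where "P n \<longleftrightarrow> 2 * int m \<le> conv_denom x (Suc n)" for n
  define n where "n = (LEAST n. P n)"
  have "P (2 * m)" unfolding P_def using conv_denom_Suc_ge[OF assms(1), of "2 * m"] by simp
  then have n: "P n" unfolding n_def by (rule LeastI)
  \<comment> \<open>Minimality of \<open>n\<close> when \<open>n > 0\<close>; for
    \<open>n = 0\<close> the denominator is 1.\<close>
  have qn: "conv_denom x n < 2 * int m"
  proof (cases n)
    case (Suc l)
    have "\<not> P l" unfolding n_def by (rule not_less_Least) (simp add: Suc flip: n_def)
    then show ?thesis by (simp add: P_def Suc)
  qed (use assms(2) in simp)
  have q: "real_of_int (conv_denom x n) \<ge> 1" "real_of_int (conv_denom x (Suc n)) \<ge> 1"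
    using conv_denom_ge_1[OF assms(1), of n] by auto
  have m: "real m > 0" using assms(2) by simp
  have "real_of_int (p * conv_denom x n - int m * conv_num x n) =
      real m * conv_error x n - conv_denom x n * (real m * x - p)"
    by (simp add: conv_error_def algebra_simps)
  also have "\<bar>\<dots>\<bar> \<le> real m * \<bar>conv_error x n\<bar> + conv_denom x n * int_dist (real m * x)"
    using q by (intro order_trans[OF abs_triangle_ineq4]) (simp add: abs_mult int_dist_def p_def)
  \<comment> \<open>The first half comes from \<open>P n\<close>, the second from \<open>qn\<close>
    and the closeness of \<open>m * x\<close> to an integer.\<close>
  also have "\<dots> < 1 / 2 + 1 / 2"
  proof (intro add_le_less_mono)
    have "real m * \<bar>conv_error x n\<bar> \<le> real m * (1 / conv_denom x (Suc n))"
      using conv_error_bounds(1)[OF assms(1), of n] by (intro mult_left_mono) auto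
    also have "2 * real m \<le> conv_denom x (Suc n)" using n unfolding P_def by linarith
    then have "real m * (1 / conv_denom x (Suc n)) \<le> 1 / 2" using q by (simp add: field_simps)
    finally show "real m * \<bar>conv_error x n\<bar> \<le> 1 / 2" .
    have "conv_denom x n * int_dist (real m * x) < conv_denom x n * (1 / (4 * real m))"
      using assms(3) q by (intro mult_strict_left_mono) auto
    also have "real_of_int (conv_denom x n) \<le> 2 * real m" using qn by linarith
    then have "conv_denom x n * (1 / (4 * real m)) \<le> 1 / 2" using m by (simp add: field_simps)
    finally show "conv_denom x n * int_dist (real m * x) < 1 / 2" .
  qed
  finally have "\<bar>p * conv_denom x n - int m * conv_num x n\<bar> < 1" by linarith
  \<comment> \<open>An integer of absolute value below 1 is zero. Coprimality then makes the
    denominator divide \<open>m\<close>.\<close>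
  then have eq: "int m * conv_num x n = p * conv_denom x n" by linarith
  then have "conv_denom x n dvd int m * conv_num x n" by simp
  then have "conv_denom x n dvd int m"
    using coprime_conv by (simp add: coprime_dvd_mult_left_iff)
  then obtain k' where k': "int m = conv_denom x n * k'" by (elim dvdE)
  have "k' > 0" using k' assms(2) q by (metis of_nat_0_less_iff zero_less_mult_pos
        of_int_0_less_iff less_le_trans zero_less_one)
  define k where "k = nat k'"
  have k: "int m = int k * conv_denom x n" "k > 0"
    using k' \<open>k' > 0\<close> by (auto simp: k_def)
  have "conv_denom x n * p = conv_denom x n * (int k * conv_num x n)"
    using eq unfolding k(1) by (simp only: mult_ac)
  then have p: "p = int k * conv_num x n" using q by auto
  have "real m = real k * conv_denom x n" using k(1) by (metis of_int_mult of_int_of_nat_eq)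
  \<comment> \<open>The integer nearest to \<open>m * x\<close> is \<open>k\<close> times the
    numerator, so the distance is \<open>k \<ge> 1\<close> times the convergent error.\<close>
  then have dist: "int_dist (real m * x) = real k * \<bar>conv_error x n\<bar>"
    unfolding int_dist_def p_def[symmetric] p conv_error_def
    by (simp add: abs_mult mult.assoc flip: right_diff_distrib)
  have "1 / (2 * conv_denom x (Suc n)) \<le> 1 * \<bar>conv_error x n\<bar>"
    using conv_error_bounds(2)[OF assms(1), of n] by simp
  also have "\<dots> \<le> int_dist (real m * x)"
    unfolding dist using k(2) by (intro mult_right_mono) auto
  finally have "ln (1 / (2 * conv_denom x (Suc n))) \<le> ln (int_dist (real m * x))"
    using q by (intro ln_mono) auto
  moreover have "ln (1 / (2 * conv_denom x (Suc n))) = - ln (2 * conv_denom x (Suc n))"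
    using q by (subst ln_div) auto
  ultimately show ?thesis using k by (intro exI[of _ n] exI[of _ k]) auto
qed

section \<open>Logarithmic distance sums at square-Brjuno numbers\<close>

lemma summable_inverse_squares: "summable (\<lambda>n. 1 / (real n)\<^sup>2)"
  using inverse_power_summable[of 2, where ?'a = real] by (simp add: inverse_eq_divide)

lemma summable_inverse_squares_Suc: "summable (\<lambda>n. 1 / (real (Suc n))\<^sup>2)"
  by (rule summable_Suc_iff[THEN iffD2, OF summable_inverse_squares])

text \<open>Since \<open>ln t \<le> 2 * t powr (1/2)\<close>, the series is dominated by inverse
  squares and the powers with exponent -3/2.\<close>

lemma summable_ln_over_square:
  assumes "c > 0"
  shows "summable (\<lambda>m. ln (c * real (Suc m)) / (real (Suc m))\<^sup>2)"
proof -
  have "summable (\<lambda>m. \<bar>ln c\<bar> * (1 / (real (Suc m))\<^sup>2) + 2 * (1 / real (Suc m) powr (3/2)))"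
  proof (intro summable_add summable_mult)
    show "summable (\<lambda>m. 1 / (real (Suc m))\<^sup>2)" by (rule summable_inverse_squares_Suc)
    have "summable (\<lambda>m. real m powr (-3/2))" by (subst summable_real_powr_iff) simp
    then show "summable (\<lambda>m. 1 / real (Suc m) powr (3/2))"
      by (subst summable_Suc_iff) (simp add: powr_minus_divide)
  qed
  moreover have "norm (ln (c * real (Suc m)) / (real (Suc m))\<^sup>2)
      \<le> \<bar>ln c\<bar> * (1 / (real (Suc m))\<^sup>2) + 2 * (1 / real (Suc m) powr (3/2))" for m
  proof -
    define t where "t = real (Suc m)"
    have t: "t \<ge> 1" by (simp add: t_def)
    have "ln t \<le> t powr (1/2) / (1/2)" using t by (intro ln_powr_bound) auto
    then have "ln t / t\<^sup>2 \<le> 2 * t powr (1/2) / t powr 2"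
      using t by (simp add: divide_right_mono)
    also have "\<dots> = 2 * t powr (1/2 - 2)" by (simp only: powr_diff times_divide_eq_right)
    also have "\<dots> = 2 * (1 / t powr (3/2))" by (simp add: powr_minus_divide)
    finally have 1: "ln t / t\<^sup>2 \<le> 2 * (1 / t powr (3/2))" .
    have "\<bar>ln (c * t)\<bar> \<le> \<bar>ln c\<bar> + ln t"
      using t assms ln_ge_zero[OF t] by (simp add: ln_mult abs_if)
    then have "\<bar>ln (c * t)\<bar> / t\<^sup>2 \<le> (\<bar>ln c\<bar> + ln t) / t\<^sup>2" by (intro divide_right_mono) auto
    also have "\<dots> = \<bar>ln c\<bar> * (1 / t\<^sup>2) + ln t / t\<^sup>2" by (simp add: add_divide_distrib)
    finally show ?thesis using 1 unfolding t_def[symmetric] by simp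
  qed
  ultimately show ?thesis by (rule summable_comparison_test')
qed

text \<open>Outside \<open>B\<close> the terms are at most \<open>ln (4 * m) / m\<^sup>2\<close>.
  Inside \<open>B\<close>, \<open>m\<close> is \<open>k\<close> times the \<open>n\<close>-th
  denominator and its term is at most \<open>t n / k\<^sup>2\<close>. Since \<open>(n, k)\<close>
  determines \<open>m\<close>, the sum over \<open>B\<close> is dominated by a product of two
  convergent series.\<close>

lemma summable_if_square_brjuno:
  assumes "square_brjuno x"
  shows "summable (\<lambda>m. - ln (int_dist (real (Suc m) * x)) / (real (Suc m))\<^sup>2)"
proof -
  have x: "x \<notin> \<rat>" using assms by (simp add: square_brjuno_def)
  define q where "q n = real_of_int (conv_denom x n)" for n
  have q: "q n \<ge> 1" for n using conv_denom_ge_1[OF x] by (simp add: q_def)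
  define L where "L m = - ln (int_dist (real (Suc m) * x)) / (real (Suc m))\<^sup>2" for m
  have L_nonneg: "L m \<ge> 0" for m
    unfolding L_def using neg_ln_int_dist_nonneg by (intro divide_nonneg_nonneg) auto
  define B where "B = {m. int_dist (real (Suc m) * x) < 1 / (4 * real (Suc m))}"
  define t where "t n = ln (2 * q (Suc n)) / (q n)\<^sup>2" for n
  have "\<forall>m\<in>B. \<exists>nk. snd nk > 0 \<and> int (Suc m) = int (snd nk) * conv_denom x (fst nk) \<and>
      - ln (int_dist (real (Suc m) * x)) \<le> ln (2 * q (Suc (fst nk)))"
  proof
    fix m assume "m \<in> B"
    then obtain n k where "k > 0 \<and> int (Suc m) = int k * conv_denom x n \<and>
        - ln (int_dist (real (Suc m) * x)) \<le> ln (2 * q (Suc n))"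
      unfolding B_def q_def using near_integer_multiple_of_convergent[OF x, of "Suc m"] by blast
    then show "\<exists>nk. snd nk > 0 \<and> int (Suc m) = int (snd nk) * conv_denom x (fst nk) \<and>
        - ln (int_dist (real (Suc m) * x)) \<le> ln (2 * q (Suc (fst nk)))"
      by (intro exI[of _ "(n, k)"]) (simp only: fst_conv snd_conv)
  qed
  then obtain \<phi> where \<phi>: "\<And>m. m \<in> B \<Longrightarrow> snd (\<phi> m) > 0"
      "\<And>m. m \<in> B \<Longrightarrow> int (Suc m) = int (snd (\<phi> m)) * conv_denom x (fst (\<phi> m))"
      "\<And>m. m \<in> B \<Longrightarrow> - ln (int_dist (real (Suc m) * x)) \<le> ln (2 * q (Suc (fst (\<phi> m))))"
    by metis
  have inj: "inj_on \<phi> B" by (intro inj_onI) (metis \<phi>(2) of_nat_eq_iff Suc_inject)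
  have t_nonneg: "t n \<ge> 0" for n
    using q[of n] q[of "Suc n"] by (auto simp: t_def intro!: divide_nonneg_nonneg ln_ge_zero)
  \<comment> \<open>The factor 2 in the logarithm costs \<open>ln 2 / (q n)\<^sup>2\<close>, which
    is summable because denominators grow at least linearly.\<close>
  have "summable t"
  proof -
    have "summable (\<lambda>n. ln 2 * (1 / (q (Suc n))\<^sup>2))"
    proof (rule summable_mult, rule summable_comparison_test'[where N = 0])
      show "summable (\<lambda>n. 1 / (real (Suc n))\<^sup>2)" by (rule summable_inverse_squares_Suc)
      fix n
      have "real (Suc n) \<le> q (Suc n)" using conv_denom_Suc_ge[OF x, of n]
        unfolding q_def by linarith
      then show "norm (1 / (q (Suc n))\<^sup>2) \<le> 1 / (real (Suc n))\<^sup>2"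
        by (auto intro!: divide_left_mono power_mono mult_pos_pos)
    qed
    then have "summable (\<lambda>n. ln 2 * (1 / (q n)\<^sup>2))"
      by (rule summable_Suc_iff[THEN iffD1])
    moreover have "summable (\<lambda>n. ln (q (Suc n)) / (q n)\<^sup>2)"
      using assms by (simp add: square_brjuno_def q_def)
    ultimately have "summable (\<lambda>n. ln 2 * (1 / (q n)\<^sup>2) + ln (q (Suc n)) / (q n)\<^sup>2)"
      by (rule summable_add)
    moreover have "t = (\<lambda>n. ln 2 * (1 / (q n)\<^sup>2) + ln (q (Suc n)) / (q n)\<^sup>2)"
    proof
      show "t n = ln 2 * (1 / (q n)\<^sup>2) + ln (q (Suc n)) / (q n)\<^sup>2" for n
        using q[of "Suc n"] by (simp add: t_def ln_mult add_divide_distrib)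
    qed
    ultimately show ?thesis by simp
  qed
  then have t_on: "t summable_on UNIV"
    using t_nonneg by (simp add: summable_on_UNIV_nonneg_real_iff)
  \<comment> \<open>The index \<open>k = 0\<close> contributes nothing, since
    \<open>1 / 0 = 0\<close>.\<close>
  have sq_on: "(\<lambda>k. 1 / (real k)\<^sup>2) summable_on UNIV"
    using summable_inverse_squares by (simp add: summable_on_UNIV_nonneg_real_iff)
  define T where "T = (\<lambda>(n, k). t n * (1 / (real k)\<^sup>2))"
  have "T summable_on Sigma UNIV (\<lambda>_. UNIV)"
  proof (rule summable_on_SigmaI)
    show "((\<lambda>k. T (n, k)) has_sum t n * infsum (\<lambda>k. 1 / (real k)\<^sup>2) UNIV) UNIV" for n
      unfolding T_def prod.case using sq_on by (intro has_sum_cmult_right has_sum_infsum)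
    show "(\<lambda>n. t n * infsum (\<lambda>k. 1 / (real k)\<^sup>2) UNIV) summable_on UNIV"
      using t_on by (rule summable_on_cmult_left)
  qed (auto simp: T_def t_nonneg)
  then have "T summable_on (\<phi> ` B)" by (rule summable_on_subset_banach) auto
  then have T_on: "(T \<circ> \<phi>) summable_on B" using inj by (simp add: summable_on_reindex)
  have "L summable_on B"
  proof (rule summable_on_comparison_test[OF T_on])
    fix m assume m: "m \<in> B"
    obtain n k where nk: "\<phi> m = (n, k)" by fastforce
    have "real_of_int (int (Suc m)) = real_of_int (int k * conv_denom x n)"
      using \<phi>(2)[OF m] by (simp only: nk fst_conv snd_conv)
    then have m_eq: "real (Suc m) = real k * q n"
      by (simp only: of_int_mult of_int_of_nat_eq q_def)
    have "L m \<le> ln (2 * q (Suc n)) / (real (Suc m))\<^sup>2"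
      unfolding L_def using \<phi>(3)[OF m] by (intro divide_right_mono) (simp_all only: nk fst_conv zero_le_power2)
    also have "\<dots> = (T \<circ> \<phi>) m"
      unfolding m_eq by (simp add: nk T_def t_def power_mult_distrib mult.commute)
    finally show "L m \<le> (T \<circ> \<phi>) m" .
  qed (rule L_nonneg)
  moreover have "L summable_on (- B)"
  proof (rule summable_on_comparison_test)
    have "summable (\<lambda>m. ln (4 * real (Suc m)) / (real (Suc m))\<^sup>2)"
      by (rule summable_ln_over_square) simp
    then have "(\<lambda>m. ln (4 * real (Suc m)) / (real (Suc m))\<^sup>2) summable_on UNIV"
      by (subst summable_on_UNIV_nonneg_real_iff) (auto intro!: divide_nonneg_nonneg ln_ge_zero)
    then show "(\<lambda>m. ln (4 * real (Suc m)) / (real (Suc m))\<^sup>2) summable_on (- B)"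
      by (rule summable_on_subset_banach) auto
    fix m assume "m \<in> - B"
    then have "ln (1 / (4 * real (Suc m))) \<le> ln (int_dist (real (Suc m) * x))"
      by (intro ln_mono) (auto simp: B_def)
    moreover have "ln (1 / (4 * real (Suc m))) = - ln (4 * real (Suc m))"
      by (subst ln_div) auto
    ultimately show "L m \<le> ln (4 * real (Suc m)) / (real (Suc m))\<^sup>2"
      unfolding L_def by (intro divide_right_mono) auto
  qed (rule L_nonneg)
  ultimately have "L summable_on (B \<union> - B)"
    by (intro summable_on_Un_disjoint) auto
  then have "summable L"
    using L_nonneg by (simp add: summable_on_UNIV_nonneg_real_iff)
  then show ?thesis by (simp add: L_def[abs_def])
qed

subsection \<open>The dilogarithm on the closed unit disc\<close>

text \<open>The term for \<open>n = 0\<close> vanishes because \<open>1 / 0 = 0\<close>.\<close>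

definition dilog :: "complex \<Rightarrow> complex" where
  "dilog z = (\<Sum>n. of_real (1 / (real n)\<^sup>2) * z ^ n)"

lemma norm_dilog_term_le:
  assumes "norm z \<le> 1"
  shows "norm (of_real (1 / (real n)\<^sup>2) * z ^ n :: complex) \<le> 1 / (real n)\<^sup>2"
proof -
  have "norm (of_real (1 / (real n)\<^sup>2) * z ^ n :: complex) = 1 / (real n)\<^sup>2 * norm z ^ n"
    by (simp add: norm_mult norm_power norm_divide)
  also have "\<dots> \<le> 1 / (real n)\<^sup>2 * 1"
    using assms by (intro mult_left_mono power_le_one) auto
  finally show ?thesis by simp
qed

lemma summable_dilog:
  assumes "norm z \<le> 1"
  shows "summable (\<lambda>n. of_real (1 / (real n)\<^sup>2) * z ^ n :: complex)"
  using summable_inverse_squares norm_dilog_term_le[OF assms]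
  by (rule summable_comparison_test'[where N = 0])

text \<open>Termwise differentiation turns \<open>D * z\<close> into the logarithm series. Keeping
  the factor \<open>z\<close> on the left avoids dividing by zero at the origin.\<close>

lemma dilog_has_field_derivative:
  assumes "norm z < 1"
  shows "\<exists>D. (dilog has_field_derivative D) (at z) \<and> D * z = - Ln (1 - z)"
proof -
  define c where "c n = (of_real (1 / (real n)\<^sup>2) :: complex)" for n
  define D where "D = (\<Sum>n. diffs c n * z ^ n)"
  have c: "summable (\<lambda>n. c n * w ^ n)" if "norm w < 1" for w
    using summable_dilog[of w] that unfolding c_def by simp
  have deriv: "(dilog has_field_derivative D) (at z)"
    using termdiffs_strong'[OF c assms] unfolding D_def dilog_def[abs_def] c_def .
  have "(\<lambda>n. of_nat n * c n * z ^ (n - Suc 0) * z) sums (D * z)"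
    unfolding D_def using assms c by (intro sums_mult2 diffs_equiv termdiff_converges[where K = 1])
  moreover have "of_nat n * c n * z ^ (n - Suc 0) * z = z ^ n / of_nat n" for n
    by (cases n) (auto simp: c_def power2_eq_square)
  moreover have "(\<lambda>n. - (- (z ^ n) / of_nat n)) sums (- Ln (1 - z))"
    using Ln_series'[of "- z"] assms by (intro sums_minus) simp
  ultimately have "D * z = - Ln (1 - z)" using sums_unique2 by auto
  with deriv show ?thesis by blast
qed

lemma dilog_circle_has_vector_derivative:
  assumes "0 \<le> r" "r < 1"
  shows "((\<lambda>t. dilog (of_real r * cis (2 * pi * t))) has_vector_derivative
    - (2 * pi * \<i>) * Ln (1 - of_real r * cis (2 * pi * t))) (at t within S)"
proof -
  define z where "z = of_real r * exp (2 * pi * \<i> * of_real t)"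
  have z: "z = of_real r * cis (2 * pi * t)" by (simp add: z_def cis_conv_exp mult_ac)
  have "norm z < 1" using assms by (simp add: z norm_mult)
  then obtain D where D: "(dilog has_field_derivative D) (at z)" "D * z = - Ln (1 - z)"
    using dilog_has_field_derivative by blast
  \<comment> \<open>The parameter is made complex so that the complex chain rule applies; its factor
    \<open>z\<close> completes \<open>D\<close> to \<open>D * z\<close>.\<close>
  have "((\<lambda>w. of_real r * exp (2 * pi * \<i> * w)) has_field_derivative z * (2 * pi * \<i>)) (at (of_real t))"
    unfolding z_def by (auto intro!: derivative_eq_intros)
  then have "((\<lambda>w. dilog (of_real r * exp (2 * pi * \<i> * w))) has_field_derivative
      D * (z * (2 * pi * \<i>))) (at (of_real t))"
    using D(1) unfolding z_def by (rule DERIV_chain2[rotated])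
  then have deriv: "((\<lambda>t. dilog (of_real r * exp (2 * pi * \<i> * of_real t))) has_vector_derivative
      D * (z * (2 * pi * \<i>))) (at t within S)"
    by (rule has_vector_derivative_real_field)
  have D_eq: "D * (z * (2 * pi * \<i>)) = - (2 * pi * \<i>) * Ln (1 - z)"
    unfolding mult.assoc[symmetric] D(2) by simp
  have fun_eq: "(\<lambda>t. dilog (of_real r * exp (2 * pi * \<i> * of_real t))) =
      (\<lambda>t. dilog (of_real r * cis (2 * pi * t)))"
    by (simp add: cis_conv_exp mult_ac)
  show ?thesis using deriv unfolding D_eq fun_eq unfolding z .
qed

text \<open>Radii increasing to 1: facts on the unit circle are obtained as limits of facts inside
  the disc, where the power series can be differentiated.\<close>

definition radius :: "nat \<Rightarrow> real" where
  "radius n = 1 - 1 / real (Suc n)"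

lemma radius_bounds: "0 \<le> radius n" "radius n < 1"
  by (simp_all add: radius_def)

lemma radius_tendsto: "radius \<longlonglongrightarrow> 1"
proof -
  have "(\<lambda>n. 1 - 1 / real (Suc n)) \<longlonglongrightarrow> 1 - 0"
    by (intro tendsto_diff tendsto_const LIMSEQ_Suc[OF lim_1_over_n])
  then show ?thesis by (simp add: radius_def[abs_def])
qed

lemma dilog_radial_limit:
  assumes "norm z \<le> 1"
  shows "(\<lambda>n. dilog (of_real (radius n) * z)) \<longlonglongrightarrow> dilog z"
proof -
  have lim: "(\<lambda>n. of_real (1 / (real k)\<^sup>2) * (of_real (radius n) * z) ^ k)
      \<longlonglongrightarrow> of_real (1 / (real k)\<^sup>2) * (of_real 1 * z) ^ k" for k
    by (intro tendsto_intros radius_tendsto)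
  have le: "norm (of_real (radius n) * z) \<le> 1" for n
    using assms radius_bounds[of n] by (auto simp: norm_mult intro!: mult_le_one)
  have "((\<lambda>n. \<Sum>k. of_real (1 / (real k)\<^sup>2) * (of_real (radius n) * z) ^ k)
      \<longlongrightarrow> (\<Sum>k. of_real (1 / (real k)\<^sup>2) * (of_real 1 * z) ^ k)) sequentially"
    using tannerys_theorem[OF lim _ summable_inverse_squares] norm_dilog_term_le[OF le]
    by (simp add: always_eventually)
  then show ?thesis by (simp add: dilog_def)
qed

subsection \<open>Distances on the unit circle\<close>

text \<open>Up to \<open>pi / 3\<close> the cosine is at least 1/2, so \<open>sin u - u / 2\<close>
  increases from 0. Beyond that, \<open>sin u\<close> is at least 17/20 while \<open>u / 2\<close>
  is at most 4/5.\<close>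

lemma sin_ge_half:
  fixes u :: real
  assumes "0 \<le> u" "u \<le> pi / 2"
  shows "u / 2 \<le> sin u"
proof (cases "u \<le> pi / 3")
  case True
  have "(\<lambda>u. sin u - u / 2) 0 \<le> (\<lambda>u. sin u - u / 2) u"
  proof (rule DERIV_nonneg_imp_nondecreasing[OF assms(1)])
    fix v assume v: "0 \<le> v" "v \<le> u"
    have "((\<lambda>u. sin u - u / 2) has_real_derivative cos v - 1 / 2) (at v)"
      by (auto intro!: derivative_eq_intros)
    moreover have "cos (pi / 3) \<le> cos v"
      using v True pi_gt_zero by (intro cos_monotone_0_pi_le) auto
    then have "cos v - 1 / 2 \<ge> 0" by (simp add: cos_60)
    ultimately show "\<exists>y. ((\<lambda>u. sin u - u / 2) has_real_derivative y) (at v) \<and> 0 \<le> y" by blast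
  qed
  then show ?thesis by simp
next
  case False
  have "sin (pi / 3) \<le> sin u"
    using False assms pi_gt_zero by (intro sin_monotone_2pi_le) auto
  moreover have "sin (pi / 3) \<ge> 17 / 20"
    unfolding sin_60 using real_le_rsqrt[of "17/10" 3] by (simp add: power2_eq_square)
  moreover have "u / 2 \<le> 4 / 5" using assms(2) pi_less_4 pi_approx by simp
  ultimately show ?thesis by simp
qed

lemma cis_round: "cis (2 * pi * (t - of_int (round t))) = cis (2 * pi * t)"
proof -
  have "cis (2 * pi * of_int (round t)) = 1"
    using cis_multiple_2pi[of "of_int (round t)"] by simp
  then show ?thesis by (simp add: right_diff_distrib flip: cis_divide)
qed

lemma norm_1_minus_cis: "norm (1 - cis (2 * pi * t)) = 2 * \<bar>sin (pi * (t - of_int (round t)))\<bar>"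
proof -
  define s where "s = t - of_int (round t)"
  have "norm (1 - cis (2 * pi * t)) = norm (exp (\<i> * of_real (2 * pi * s)) - 1)"
    unfolding s_def cis_conv_exp[symmetric] cis_round by (rule norm_minus_commute)
  also have "\<dots> = 2 * \<bar>sin (pi * s)\<bar>" by (subst dist_exp_i_1) simp
  finally show ?thesis by (simp add: s_def)
qed

lemma norm_1_minus_cis_le: "norm (1 - cis (2 * pi * t)) \<le> 2 * pi * int_dist t"
  unfolding norm_1_minus_cis int_dist_def
  using abs_sin_x_le_abs_x[of "pi * (t - of_int (round t))"] by (simp add: abs_mult)

lemma norm_1_minus_cis_ge: "2 * int_dist t \<le> norm (1 - cis (2 * pi * t))"
proof -
  define s where "s = t - of_int (round t)"
  have s: "\<bar>s\<bar> \<le> 1 / 2" using int_dist_le_half[of t] by (simp add: s_def int_dist_def)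
  have "pi * \<bar>s\<bar> / 2 \<le> sin (pi * \<bar>s\<bar>)"
    using s by (intro sin_ge_half) (auto simp: field_simps)
  also have "\<dots> \<le> \<bar>sin (pi * s)\<bar>" by (cases "s \<ge> 0") auto
  finally have "pi * \<bar>s\<bar> / 2 \<le> \<bar>sin (pi * s)\<bar>" .
  moreover have "2 * \<bar>s\<bar> \<le> pi * \<bar>s\<bar>" using pi_ge_two by (intro mult_right_mono) auto
  ultimately show ?thesis
    unfolding norm_1_minus_cis s_def[symmetric] int_dist_def[of t, folded s_def] by linarith
qed

text \<open>Moving from \<open>e\<close> to \<open>r * e\<close> costs \<open>1 - r\<close>, which
  is itself at most the distance from 1 to \<open>r * e\<close>. So scaling at most halves the
  distance to 1.\<close>

lemma norm_1_minus_scaled_cis_ge: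
  assumes "0 \<le> r" "r \<le> 1"
  shows "int_dist t \<le> norm (1 - of_real r * cis (2 * pi * t))"
proof -
  define e where "e = cis (2 * pi * t)"
  have e: "norm e = 1" by (simp add: e_def)
  have "norm (1 - e) \<le> norm (1 - of_real r * e) + norm (of_real r * e - e)"
    using norm_triangle_ineq[of "1 - of_real r * e" "of_real r * e - e"] by simp
  also have "of_real r * e - e = of_real (r - 1) * e" by (simp add: algebra_simps)
  also have "norm \<dots> = 1 - r" using assms e by (simp only: norm_mult norm_of_real) simp
  also have "1 - r = norm (1 :: complex) - norm (of_real r * e)"
    using assms e by (simp add: norm_mult)
  also have "\<dots> \<le> norm (1 - of_real r * e)" by (rule norm_triangle_ineq2)
  finally show ?thesis using norm_1_minus_cis_ge[of t] by (simp add: e_def)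
qed

text \<open>From \<open>norm (1 - w) \<le> 1\<close> follows that \<open>2 * Re w\<close> is at
  least the square of \<open>norm w\<close>, which is positive. So \<open>Ln\<close> is evaluated
  off its branch cut and its imaginary part stays below \<open>pi / 2\<close>.\<close>

lemma Re_1_minus_scaled_cis_pos:
  assumes "0 \<le> r" "r \<le> 1" "r < 1 \<or> t \<notin> \<int>"
  shows "0 < Re (1 - of_real r * cis (2 * pi * t))"
proof -
  define w where "w = 1 - of_real r * cis (2 * pi * t)"
  have w: "r * cos (2 * pi * t) = 1 - Re w" by (simp add: w_def)
  have "norm (of_real r * cis (2 * pi * t) :: complex) \<le> 1" using assms by (simp add: norm_mult)
  then have le: "norm (1 - w) \<le> 1" by (simp add: w_def)
  have "w \<noteq> 0"
  proof (cases "t \<in> \<int>")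
    case True
    then have "norm (of_real r * cis (2 * pi * t) :: complex) < 1"
      using assms by (simp add: norm_mult)
    then show ?thesis by (auto simp: w_def)
  next
    case False
    then show ?thesis
      using int_dist_pos norm_1_minus_scaled_cis_ge[OF assms(1,2), of t] by (fastforce simp: w_def)
  qed
  have "(Re w)\<^sup>2 + (Im w)\<^sup>2 > 0" using \<open>w \<noteq> 0\<close> by (simp add: complex_neq_0)
  moreover have "(1 - Re w)\<^sup>2 + (Im w)\<^sup>2 \<le> 1"
    using power_mono[OF le, of 2] by (simp add: cmod_power2)
  ultimately have "2 * Re w > 0" by (simp add: power2_eq_square algebra_simps)
  then show ?thesis by (simp add: w_def)
qed

lemma norm_1_minus_scaled_cis_le:
  assumes "0 \<le> r" "r \<le> 1"
  shows "norm (1 - of_real r * cis (2 * pi * t)) \<le> 2"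
  using norm_triangle_ineq4[of 1 "of_real r * cis (2 * pi * t)"] assms by (simp add: norm_mult)

text \<open>The real part is controlled by \<open>d \<le> norm w \<le> 2\<close>, the imaginary part
  by the right half-plane. The bound is uniform in \<open>r\<close>, so it survives the limit to the
  circle.\<close>

lemma norm_Ln_1_minus_scaled_cis_le:
  assumes "0 \<le> r" "r \<le> 1" "0 < d" "d \<le> 1 / 2" "d \<le> int_dist t"
  shows "norm (Ln (1 - of_real r * cis (2 * pi * t))) \<le> ln 2 - ln d + pi / 2"
proof -
  define w where "w = 1 - of_real r * cis (2 * pi * t)"
  have w: "d \<le> norm w" "norm w \<le> 2"
    using norm_1_minus_scaled_cis_ge[of r t] norm_1_minus_scaled_cis_le[of r t] assms
    by (auto simp: w_def)
  have t: "t \<notin> \<int>" using assms(3,5) by (auto simp: int_dist_def elim!: Ints_cases)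
  have Re: "Re w > 0" unfolding w_def using assms t by (intro Re_1_minus_scaled_cis_pos) auto
  then have "w \<noteq> 0" by auto
  have "norm (Ln w) \<le> \<bar>Re (Ln w)\<bar> + \<bar>Im (Ln w)\<bar>" by (rule cmod_le)
  also have "\<bar>Im (Ln w)\<bar> \<le> pi / 2" using Re_Ln_pos_lt_imp[OF Re] by simp
  also have "\<bar>Re (Ln w)\<bar> \<le> ln 2 - ln d"
  proof -
    have "ln d \<le> ln (norm w)" "ln (norm w) \<le> ln 2" "ln d \<le> 0"
      using w assms by (auto intro!: ln_mono)
    moreover have "ln (2::real) \<ge> 0" by simp
    ultimately have "\<bar>ln (norm w)\<bar> \<le> ln 2 - ln d" by linarith
    then show ?thesis using \<open>w \<noteq> 0\<close> by (simp add: Re_Ln)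
  qed
  finally show ?thesis by (simp add: w_def)
qed

subsection \<open>The dilogarithm on the unit circle\<close>

definition circle_dilog :: "real \<Rightarrow> complex" where
  "circle_dilog t = dilog (cis (2 * pi * t))"

abbreviation circle_approx :: "nat \<Rightarrow> real \<Rightarrow> complex" where
  "circle_approx n t \<equiv> dilog (of_real (radius n) * cis (2 * pi * t))"

abbreviation circle_approx_deriv :: "nat \<Rightarrow> real \<Rightarrow> complex" where
  "circle_approx_deriv n t \<equiv> - (2 * pi * \<i>) * Ln (1 - of_real (radius n) * cis (2 * pi * t))"

lemma circle_approx_tendsto: "(\<lambda>n. circle_approx n t) \<longlonglongrightarrow> circle_dilog t"
  unfolding circle_dilog_def by (rule dilog_radial_limit) simp

lemma circle_approx_deriv:
  "(circle_approx n has_vector_derivative circle_approx_deriv n t) (at t within S)"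
  using radius_bounds by (rule dilog_circle_has_vector_derivative)

lemma int_dist_nearby: "int_dist y - \<bar>t - y\<bar> \<le> int_dist t"
proof -
  have "int_dist y \<le> \<bar>y - of_int (round t)\<bar>" by (rule int_dist_le)
  then show ?thesis unfolding int_dist_def[of t] by linarith
qed

text \<open>On a ball that stays away from the integers the derivatives of the radial approximations
  converge uniformly, so the limit can be differentiated.\<close>

lemma circle_dilog_has_vector_derivative:
  assumes "y \<notin> \<int>"
  shows "(circle_dilog has_vector_derivative - (2 * pi * \<i>) * Ln (1 - cis (2 * pi * y))) (at y)"
proof -
  define d where "d = int_dist y / 2"
  have d: "d > 0" using int_dist_pos[OF assms] by (simp add: d_def)
  define S where "S = cball y d"
  define g' where "g' t = - (2 * pi * \<i>) * Ln (1 - cis (2 * pi * t))" for t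
  have S: "d \<le> int_dist t" if "t \<in> S" for t
    using int_dist_nearby[of y t] that
    by (simp add: S_def d_def dist_real_def abs_minus_commute)
  have deriv_lim: "norm (circle_approx_deriv n t - g' t) \<le> 2 * pi * (1 / d * (1 - radius n))"
    if t: "t \<in> S" for n t
  proof -
    \<comment> \<open>All points of this segment have the form 1 minus a scaled \<open>cis\<close>.
      There \<open>inverse\<close>, the derivative of \<open>Ln\<close>, is bounded by
      \<open>1 / d\<close>, and the segment has length \<open>1 - radius n\<close>.\<close>
    define T where "T = closed_segment (1 - of_real (radius n) * cis (2 * pi * t)) (1 - cis (2 * pi * t))"
    have "t \<notin> \<int>" using S[OF t] d by (auto simp: int_dist_def elim!: Ints_cases)
    have T: "\<exists>r. 0 \<le> r \<and> r \<le> 1 \<and> w = 1 - of_real r * cis (2 * pi * t)" if w: "w \<in> T" for w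
    proof -
      obtain u where u: "0 \<le> u" "u \<le> 1" "w = (1 - u) *\<^sub>R (1 - of_real (radius n) * cis (2 * pi * t))
          + u *\<^sub>R (1 - cis (2 * pi * t))"
        using w[unfolded T_def in_segment(1)] by (elim exE conjE) (rule that)
      have "w = 1 - of_real ((1 - u) * radius n + u * 1) * cis (2 * pi * t)"
        unfolding u(3) by (simp add: scaleR_conv_of_real algebra_simps)
      moreover have "(1 - u) * radius n + u * 1 \<le> 1"
        using u radius_bounds[of n] by (intro convex_bound_le) auto
      ultimately show ?thesis
        using u radius_bounds[of n] by (intro exI[of _ "(1 - u) * radius n + u * 1"]) auto
    qed
    have "norm (Ln (1 - of_real (radius n) * cis (2 * pi * t)) - Ln (1 - cis (2 * pi * t)))
        \<le> 1 / d * norm ((1 - of_real (radius n) * cis (2 * pi * t)) - (1 - cis (2 * pi * t)))"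
    proof (rule field_differentiable_bound[where S = T and f = Ln and f' = inverse])
      fix w assume "w \<in> T"
      then obtain r where r: "0 \<le> r" "r \<le> 1" "w = 1 - of_real r * cis (2 * pi * t)"
        using T by blast
      have "Re w > 0" unfolding r(3) using r \<open>t \<notin> \<int>\<close> by (intro Re_1_minus_scaled_cis_pos) auto
      then have "w \<notin> \<real>\<^sub>\<le>\<^sub>0" by (simp add: complex_nonpos_Reals_iff)
      then show "(Ln has_field_derivative inverse w) (at w within T)"
        by (rule has_field_derivative_at_within[OF has_field_derivative_Ln])
      have "d \<le> norm w"
        unfolding r(3) using S[OF t] norm_1_minus_scaled_cis_ge[OF r(1,2), of t] by linarith
      then show "norm (inverse w) \<le> 1 / d"
        using d by (simp add: inverse_eq_divide norm_divide frac_le)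
    qed (auto simp: T_def)
    also have "(1 - of_real (radius n) * cis (2 * pi * t)) - (1 - cis (2 * pi * t)) =
        of_real (1 - radius n) * cis (2 * pi * t)"
      by (simp add: algebra_simps)
    also have "norm \<dots> = 1 - radius n"
      using radius_bounds[of n] by (simp only: norm_mult norm_of_real norm_cis) simp
    finally have "2 * pi * norm (Ln (1 - of_real (radius n) * cis (2 * pi * t)) -
        Ln (1 - cis (2 * pi * t))) \<le> 2 * pi * (1 / d * (1 - radius n))"
      by (intro mult_left_mono) auto
    then show ?thesis
      unfolding g'_def right_diff_distrib[symmetric] norm_mult by (simp add: norm_mult)
  qed
  have "\<exists>g. \<forall>t\<in>S. (\<lambda>n. circle_approx n t) \<longlonglongrightarrow> g t \<and>
      (g has_derivative (\<lambda>h. h *\<^sub>R g' t)) (at t within S)"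
  proof (rule has_derivative_sequence)
    show "convex S" "y \<in> S" using d by (auto simp: S_def)
    show "(\<lambda>n. circle_approx n y) \<longlonglongrightarrow> circle_dilog y"
      by (rule circle_approx_tendsto)
    show "(circle_approx n has_derivative (\<lambda>h. h *\<^sub>R circle_approx_deriv n t)) (at t within S)" for n t
      using circle_approx_deriv unfolding has_vector_derivative_def .
    fix e :: real assume "e > 0"
    have "(\<lambda>n. 2 * pi * (1 / d * (1 - radius n))) \<longlonglongrightarrow> 2 * pi * (1 / d * (1 - 1))"
      by (intro tendsto_intros radius_tendsto)
    then have "\<forall>\<^sub>F n in sequentially. 2 * pi * (1 / d * (1 - radius n)) < e"
      using \<open>e > 0\<close> by (intro order_tendstoD(2)) auto
    then show "\<forall>\<^sub>F n in sequentially. \<forall>t\<in>S. \<forall>h.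
        norm (h *\<^sub>R circle_approx_deriv n t - h *\<^sub>R g' t) \<le> e * norm h"
    proof eventually_elim
      case (elim n)
      have "norm (h *\<^sub>R circle_approx_deriv n t - h *\<^sub>R g' t) \<le> e * norm h" if "t \<in> S" for t h
      proof -
        have "norm (h *\<^sub>R circle_approx_deriv n t - h *\<^sub>R g' t) =
            norm h * norm (circle_approx_deriv n t - g' t)"
          unfolding scaleR_right_diff_distrib[symmetric] by (rule norm_scaleR[unfolded real_norm_def[symmetric]])
        also have "\<dots> \<le> norm h * e"
          using deriv_lim[OF that, of n] elim by (intro mult_left_mono) auto
        finally show ?thesis by (simp add: mult.commute)
      qed
      then show ?case by blast
    qed
  qed
  then obtain g where g: "\<And>t. t \<in> S \<Longrightarrow> (\<lambda>n. circle_approx n t) \<longlonglongrightarrow> g t"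
      "\<And>t. t \<in> S \<Longrightarrow> (g has_derivative (\<lambda>h. h *\<^sub>R g' t)) (at t within S)"
    by blast
  have y: "y \<in> interior S" using d by (simp add: S_def)
  then have "(g has_derivative (\<lambda>h. h *\<^sub>R g' y)) (at y)"
    using g(2)[of y] interior_subset by (metis at_within_interior subsetD)
  \<comment> \<open>The limit theorem only provides some limit function \<open>g\<close>; uniqueness
    of limits identifies it.\<close>
  moreover have "g t = circle_dilog t" if "t \<in> interior S" for t
    using LIMSEQ_unique[OF g(1) circle_approx_tendsto] that interior_subset by blast
  ultimately have "(circle_dilog has_derivative (\<lambda>h. h *\<^sub>R g' y)) (at y)"
    by (rule has_derivative_transform_within_open[OF _ open_interior y])
  then show ?thesis by (simp add: has_vector_derivative_def g'_def)
qed

text \<open>The mean value inequality for the approximations has a constant independent of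
  \<open>n\<close> and passes to the limit.\<close>

lemma circle_dilog_lipschitz_away_from_integers:
  assumes "0 < d" "d \<le> 1 / 2" "convex S" "\<And>t. t \<in> S \<Longrightarrow> d \<le> int_dist t" "a \<in> S" "b \<in> S"
  shows "norm (circle_dilog b - circle_dilog a) \<le> 2 * pi * (ln 2 - ln d + pi / 2) * \<bar>b - a\<bar>"
proof (rule LIMSEQ_le_const2)
  show "(\<lambda>n. norm (circle_approx n b - circle_approx n a)) \<longlonglongrightarrow>
      norm (circle_dilog b - circle_dilog a)"
    by (intro tendsto_intros circle_approx_tendsto)
  have "norm (circle_approx n b - circle_approx n a)
      \<le> 2 * pi * (ln 2 - ln d + pi / 2) * norm (b - a)" for n
  proof (rule differentiable_bound[OF assms(3) _ _ assms(6,5)])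
    fix t assume t: "t \<in> S"
    show "(circle_approx n has_derivative (\<lambda>h. h *\<^sub>R circle_approx_deriv n t)) (at t within S)"
      using circle_approx_deriv unfolding has_vector_derivative_def .
    have "norm (circle_approx_deriv n t) \<le> 2 * pi * (ln 2 - ln d + pi / 2)"
      using norm_Ln_1_minus_scaled_cis_le[OF _ _ assms(1,2) assms(4)[OF t], of "radius n"] radius_bounds[of n]
      by (simp add: norm_mult)
    then show "onorm (\<lambda>h. h *\<^sub>R circle_approx_deriv n t) \<le> 2 * pi * (ln 2 - ln d + pi / 2)"
      by (intro onorm_le) (simp only: norm_scaleR mult.commute mult_left_mono norm_ge_zero real_norm_def abs_ge_zero)
  qed
  then show "\<exists>N. \<forall>n\<ge>N. norm (circle_approx n b - circle_approx n a)
      \<le> 2 * pi * (ln 2 - ln d + pi / 2) * \<bar>b - a\<bar>"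
    by auto
qed

text \<open>The derivative of the real part is \<open>2 * pi\<close> times an argument of size below
  \<open>pi / 2\<close>. The approximations are differentiable everywhere, so the estimate also
  holds across integers.\<close>

lemma Re_circle_dilog_lipschitz:
  "\<bar>Re (circle_dilog b) - Re (circle_dilog a)\<bar> \<le> pi\<^sup>2 * \<bar>b - a\<bar>"
proof (rule LIMSEQ_le_const2)
  show "(\<lambda>n. \<bar>Re (circle_approx n b) - Re (circle_approx n a)\<bar>) \<longlonglongrightarrow>
      \<bar>Re (circle_dilog b) - Re (circle_dilog a)\<bar>"
    by (intro tendsto_intros circle_approx_tendsto)
  have "norm (Re (circle_approx n b) - Re (circle_approx n a)) \<le> pi\<^sup>2 * norm (b - a)" for n
  proof (rule field_differentiable_bound[of UNIV])
    fix t
    show "((\<lambda>t. Re (circle_approx n t)) has_field_derivative Re (circle_approx_deriv n t)) (at t within UNIV)"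
      using circle_approx_deriv[of n t UNIV]
      unfolding has_real_derivative_iff_has_vector_derivative
      by (rule bounded_linear.has_vector_derivative[OF bounded_linear_Re])
    have "0 < Re (1 - of_real (radius n) * cis (2 * pi * t))"
      using radius_bounds[of n] by (intro Re_1_minus_scaled_cis_pos) auto
    then have "\<bar>Im (Ln (1 - of_real (radius n) * cis (2 * pi * t)))\<bar> < pi / 2"
      by (rule Re_Ln_pos_lt_imp)
    then have "2 * pi * \<bar>Im (Ln (1 - of_real (radius n) * cis (2 * pi * t)))\<bar> \<le> 2 * pi * (pi / 2)"
      by (intro mult_left_mono) auto
    then show "norm (Re (circle_approx_deriv n t)) \<le> pi\<^sup>2"
      by (simp add: abs_mult power2_eq_square)
  qed auto
  then show "\<exists>N. \<forall>n\<ge>N. \<bar>Re (circle_approx n b) - Re (circle_approx n a)\<bar> \<le> pi\<^sup>2 * \<bar>b - a\<bar>"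
    by auto
qed

text \<open>The derivative of the imaginary part is \<open>- 2 * pi * ln (norm w)\<close> with
  \<open>norm w \<le> 2\<close>. This one-sided bound supplies the nonnegativity for Fatou's
  lemma.\<close>

lemma Im_circle_dilog_slope_ge:
  assumes "a \<le> b"
  shows "- (2 * pi * ln 2) * (b - a) \<le> Im (circle_dilog b) - Im (circle_dilog a)"
proof (rule LIMSEQ_le_const)
  show "(\<lambda>n. Im (circle_approx n b) - Im (circle_approx n a)) \<longlonglongrightarrow>
      Im (circle_dilog b) - Im (circle_dilog a)"
    by (intro tendsto_intros circle_approx_tendsto)
  have "Im (circle_approx n a) + 2 * pi * ln 2 * a \<le> Im (circle_approx n b) + 2 * pi * ln 2 * b" for n
  proof (rule DERIV_nonneg_imp_nondecreasing[OF assms, where f = "\<lambda>t. Im (circle_approx n t) + 2 * pi * ln 2 * t"],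
      intro exI conjI)
    fix t
    have "((\<lambda>t. Im (circle_approx n t)) has_field_derivative Im (circle_approx_deriv n t)) (at t)"
      using circle_approx_deriv[of n t UNIV]
      unfolding has_real_derivative_iff_has_vector_derivative
      by (rule bounded_linear.has_vector_derivative[OF bounded_linear_Im])
    then show "((\<lambda>t. Im (circle_approx n t) + 2 * pi * ln 2 * t) has_field_derivative
        Im (circle_approx_deriv n t) + 2 * pi * ln 2) (at t)"
      by (intro DERIV_add) (auto intro!: derivative_eq_intros)
    define w where "w = 1 - of_real (radius n) * cis (2 * pi * t)"
    have "Re w > 0"
      unfolding w_def using radius_bounds[of n] by (intro Re_1_minus_scaled_cis_pos) auto
    then have "w \<noteq> 0" by auto
    moreover have "norm w \<le> 2"
      unfolding w_def using radius_bounds[of n] by (intro norm_1_minus_scaled_cis_le) auto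
    ultimately have "Re (Ln w) \<le> ln 2" by (simp add: Re_Ln)
    then have "2 * pi * Re (Ln w) \<le> 2 * pi * ln 2" by (intro mult_left_mono) auto
    then show "0 \<le> Im (circle_approx_deriv n t) + 2 * pi * ln 2"
      unfolding w_def[symmetric] by simp
  qed
  then show "\<exists>N. \<forall>n\<ge>N. - (2 * pi * ln 2) * (b - a) \<le> Im (circle_approx n b) - Im (circle_approx n a)"
    by (auto simp: algebra_simps)
qed

lemma norm_cis_diff_le: "norm (cis \<alpha> - cis \<beta>) \<le> \<bar>\<alpha> - \<beta>\<bar>"
proof -
  have "cis \<alpha> - cis \<beta> = cis \<beta> * (cis (\<alpha> - \<beta>) - 1)"
    by (simp add: right_diff_distrib cis_mult)
  then have "norm (cis \<alpha> - cis \<beta>) = norm (exp (\<i> * of_real (\<alpha> - \<beta>)) - 1)"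
    by (simp add: norm_mult cis_conv_exp)
  also have "\<dots> = 2 * \<bar>sin ((\<alpha> - \<beta>) / 2)\<bar>" by (rule dist_exp_i_1)
  also have "\<dots> \<le> \<bar>\<alpha> - \<beta>\<bar>" using abs_sin_x_le_abs_x[of "(\<alpha> - \<beta>) / 2"] by simp
  finally show ?thesis .
qed

text \<open>The difference \<open>harm n - ln n\<close> decreases from its value 1 at
  \<open>n = 1\<close>.\<close>

lemma harm_le_1_plus_ln:
  assumes "n > 0"
  shows "harm n \<le> 1 + ln (real n)"
  using euler_mascheroni_sequence_decreasing[of 1 n] assms by (simp add: harm_expand)

text \<open>The series is cut near \<open>1 / \<delta>\<close>. Low terms are at most
  \<open>2 * pi * \<delta> / n\<close> and sum to a logarithm; the terms of the tail are at most
  \<open>2 / n\<^sup>2\<close>, and telescoping bounds their sum by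
  \<open>2 * \<delta>\<close>.\<close>

lemma circle_dilog_modulus_of_continuity:
  assumes "\<delta> > 0" "\<bar>a - b\<bar> = \<delta>"
  shows "norm (circle_dilog a - circle_dilog b) \<le> \<delta> * (2 * pi + 2 + 2 * pi * ln (1 + 1 / \<delta>))"
proof -
  define T where "T n = of_real (1 / (real n)\<^sup>2) * cis (2 * pi * a) ^ n
      - of_real (1 / (real n)\<^sup>2) * cis (2 * pi * b) ^ n" for n
  have sm: "summable (\<lambda>n. of_real (1 / (real n)\<^sup>2) * cis (2 * pi * c) ^ n :: complex)" for c
    by (rule summable_dilog) simp
  have T: "summable T" unfolding T_def[abs_def] by (intro summable_diff sm)
  have eq: "circle_dilog a - circle_dilog b = suminf T"
    unfolding circle_dilog_def dilog_def T_def by (rule suminf_diff[OF sm sm])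
  have norm_T: "norm (T n) = 1 / (real n)\<^sup>2 * norm (cis (real n * (2 * pi * a)) - cis (real n * (2 * pi * b)))" for n
    unfolding T_def Complex.DeMoivre right_diff_distrib[symmetric] norm_mult
    by (simp add: norm_divide norm_power)
  have T1: "norm (T n) \<le> 2 * pi * \<delta> * inverse (real n)" for n
  proof (cases "n = 0")
    case False
    have "norm (T n) \<le> 1 / (real n)\<^sup>2 * \<bar>real n * (2 * pi * a) - real n * (2 * pi * b)\<bar>"
      unfolding norm_T by (intro mult_left_mono norm_cis_diff_le) auto
    also have "real n * (2 * pi * a) - real n * (2 * pi * b) = real n * (2 * pi * (a - b))"
      by (simp add: algebra_simps)
    also have "\<bar>real n * (2 * pi * (a - b))\<bar> = real n * (2 * pi * \<delta>)"
      using assms(2) by (simp add: abs_mult)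
    also have "1 / (real n)\<^sup>2 * (real n * (2 * pi * \<delta>)) = 2 * pi * \<delta> * inverse (real n)"
      using False by (simp add: power2_eq_square field_simps)
    finally show ?thesis .
  qed (simp add: T_def)
  have T2: "norm (T n) \<le> 2 * (1 / (real n)\<^sup>2)" for n
    unfolding norm_T
    using norm_triangle_ineq4[of "cis (real n * (2 * pi * a))" "cis (real n * (2 * pi * b))"]
      mult_left_mono[of _ 2 "1 / (real n)\<^sup>2"] by fastforce
  define N where "N = nat \<lceil>1 / \<delta>\<rceil>"
  have "1 / \<delta> > 0" using assms by simp
  then have N: "N > 0" "1 / \<delta> \<le> real N" "real N \<le> 1 + 1 / \<delta>"
    unfolding N_def by linarith+
  have "suminf T = (\<Sum>n. T (n + Suc N)) + (\<Sum>n<Suc N. T n)"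
    by (rule suminf_split_initial_segment[OF T])
  also have "norm \<dots> \<le> 2 * (1 / real N) + 2 * pi * \<delta> * (1 + ln (real N))"
  proof (intro order_trans[OF norm_triangle_ineq] add_mono)
    have tel: "(\<lambda>n. 2 * (1 / real (n + N) - 1 / real (Suc n + N))) sums (2 * (1 / real (0 + N) - 0))"
      by (intro sums_mult telescope_sums' LIMSEQ_ignore_initial_segment[OF lim_1_over_n])
    have le: "norm (T (n + Suc N)) \<le> 2 * (1 / real (n + N) - 1 / real (Suc n + N))" for n
    proof -
      have "1 / (real (n + Suc N))\<^sup>2 \<le> 1 / real (n + N) - 1 / real (Suc n + N)"
      proof -
        define k where "k = real (n + N)"
        have "k > 0" using N(1) by (simp add: k_def)
        then have "1 / (k + 1)\<^sup>2 \<le> 1 / (k * (k + 1))"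
          by (intro divide_left_mono) (auto simp: power2_eq_square)
        also have "\<dots> = 1 / k - 1 / (k + 1)" using \<open>k > 0\<close> by (simp add: field_simps)
        finally show ?thesis by (simp add: k_def add_ac)
      qed
      then show ?thesis by (intro order_trans[OF T2] mult_left_mono) auto
    qed
    have "norm (\<Sum>n. T (n + Suc N)) \<le> (\<Sum>n. 2 * (1 / real (n + N) - 1 / real (Suc n + N)))"
      using le tel by (intro norm_suminf_le) (auto simp: sums_iff)
    also have "\<dots> = 2 * (1 / real N)" using tel by (simp add: sums_iff)
    finally show "norm (\<Sum>n. T (n + Suc N)) \<le> 2 * (1 / real N)" .
    have "norm (\<Sum>n<Suc N. T n) \<le> (\<Sum>n<Suc N. 2 * pi * \<delta> * inverse (real n))"
      by (rule order_trans[OF norm_sum sum_mono]) (rule T1)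
    also have "\<dots> = 2 * pi * \<delta> * harm N"
      by (subst sum.lessThan_Suc_shift) (simp add: harm_altdef sum_distrib_left del: of_nat_Suc)
    also have "\<dots> \<le> 2 * pi * \<delta> * (1 + ln (real N))"
      using assms(1) harm_le_1_plus_ln[OF N(1)] by (intro mult_left_mono) auto
    finally show "norm (\<Sum>n<Suc N. T n) \<le> 2 * pi * \<delta> * (1 + ln (real N))" .
  qed
  also have "\<dots> \<le> 2 * \<delta> + 2 * pi * \<delta> * (1 + ln (1 + 1 / \<delta>))"
  proof (intro add_mono mult_left_mono)
    show "1 / real N \<le> \<delta>" using N assms(1) by (simp add: field_simps)
    show "ln (real N) \<le> ln (1 + 1 / \<delta>)" using N by (intro ln_mono) auto
  qed (use assms in auto)
  finally show ?thesis unfolding eq by (simp add: algebra_simps)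
qed

text \<open>If the increment is at most half the distance to the integers, the Lipschitz estimate
  applies. Otherwise \<open>1 / \<bar>u\<bar>\<close> is at most \<open>2 / d\<close>, and the
  modulus of continuity gives the same logarithm.\<close>

lemma circle_dilog_slope_le:
  assumes "y \<notin> \<int>"
  shows "norm (circle_dilog (y + u) - circle_dilog y)
    \<le> (2 * pi + 2 + 2 * pi * ln 4 + pi\<^sup>2 - 2 * pi * ln (int_dist y)) * \<bar>u\<bar>"
proof (cases "u = 0")
  case False
  define d where "d = int_dist y"
  have d: "0 < d" "d \<le> 1 / 2"
    using int_dist_pos[OF assms] int_dist_le_half[of y] by (auto simp: d_def)
  have ln4: "ln (4::real) = 2 * ln 2" using ln_realpow[of 2 2] by simp
  show ?thesis
  proof (cases "\<bar>u\<bar> \<le> d / 2")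
    case True
    have "norm (circle_dilog (y + u) - circle_dilog y)
        \<le> 2 * pi * (ln 2 - ln (d / 2) + pi / 2) * \<bar>(y + u) - y\<bar>"
    proof (rule circle_dilog_lipschitz_away_from_integers[where S = "cball y (d / 2)"])
      fix t assume "t \<in> cball y (d / 2)"
      then show "d / 2 \<le> int_dist t"
        using int_dist_nearby[of y t] by (simp add: d_def dist_real_def abs_minus_commute)
    qed (use d True in \<open>auto simp: dist_real_def\<close>)
    also have "ln (d / 2) = ln d - ln 2" using d by (subst ln_div) auto
    \<comment> \<open>The left factor equals
      \<open>2 * pi * ln 4 + pi\<^sup>2 - 2 * pi * ln d\<close>; the remaining
      \<open>2 * pi + 2\<close> is for the other case.\<close>
    also have "2 * pi * (ln 2 - (ln d - ln 2) + pi / 2) * \<bar>(y + u) - y\<bar>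
        \<le> (2 * pi + 2 + 2 * pi * ln 4 + pi\<^sup>2 - 2 * pi * ln d) * \<bar>u\<bar>"
      unfolding ln4 using pi_gt_zero
      by (simp add: algebra_simps power2_eq_square mult_right_mono)
    finally show ?thesis by (simp add: d_def)
  next
    case False
    have "norm (circle_dilog (y + u) - circle_dilog y)
        \<le> \<bar>u\<bar> * (2 * pi + 2 + 2 * pi * ln (1 + 1 / \<bar>u\<bar>))"
      using \<open>u \<noteq> 0\<close> by (intro circle_dilog_modulus_of_continuity) auto
    also have "\<dots> \<le> \<bar>u\<bar> * (2 * pi + 2 + 2 * pi * ln 4 + pi\<^sup>2 - 2 * pi * ln d)"
    proof (intro mult_left_mono)
      have "1 / \<bar>u\<bar> \<le> 2 / d" using False d by (simp add: field_simps)
      moreover have "1 + 2 / d \<le> 4 / d" using d by (simp add: field_simps)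
      ultimately have "ln (1 + 1 / \<bar>u\<bar>) \<le> ln (4 / d)"
        by (intro ln_mono) (auto intro: add_pos_nonneg)
      also have "\<dots> = ln 4 - ln d" using d by (subst ln_div) auto
      finally have "2 * pi * ln (1 + 1 / \<bar>u\<bar>) \<le> 2 * pi * (ln 4 - ln d)"
        by (intro mult_left_mono) auto
      then show "2 * pi + 2 + 2 * pi * ln (1 + 1 / \<bar>u\<bar>) \<le> 2 * pi + 2 + 2 * pi * ln 4 + pi\<^sup>2 - 2 * pi * ln d"
        using zero_le_power2[of pi] unfolding right_diff_distrib by linarith
    qed auto
    finally show ?thesis by (simp add: d_def mult.commute)
  qed
qed simp

lemma norm_circle_dilog_le: "norm (circle_dilog t) \<le> (\<Sum>n. 1 / (real n)\<^sup>2)"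
  unfolding circle_dilog_def dilog_def
  by (intro norm_suminf_le norm_dilog_term_le summable_inverse_squares) simp

subsection \<open>Rearranging the Eisenstein series\<close>

text \<open>The double family is absolutely summable, so it can be summed by rows, giving
  dilogarithms, or along \<open>m * d = n\<close>, where each term has weight
  \<open>d / n ^ 3\<close>.\<close>

lemma sigma1_series_has_sum:
  fixes x :: real
  defines "f \<equiv> \<lambda>(m, d). of_real (1 / real m ^ 3 * (1 / (real d)\<^sup>2)) * cis (2 * pi * (real m * real d * x))"
  shows "\<exists>S. ((\<lambda>m. of_real (1 / real m ^ 3) * circle_dilog (real m * x)) has_sum S) UNIV \<and>
    ((\<lambda>n. of_real (real (sigma1 n) / real n ^ 3) * cis (2 * pi * (real n * x))) has_sum S) {1..}"
proof -
  have sq_on: "(\<lambda>d. 1 / (real d)\<^sup>2) summable_on UNIV"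
    using summable_inverse_squares by (simp add: summable_on_UNIV_nonneg_real_iff)
  have "summable (\<lambda>m. 1 / real m ^ 3)"
    using inverse_power_summable[of 3, where ?'a = real] by (simp add: inverse_eq_divide)
  then have cube_on: "(\<lambda>m. 1 / real m ^ 3) summable_on UNIV"
    by (simp add: summable_on_UNIV_nonneg_real_iff)
  have norm_f: "norm (f (m, d)) = 1 / real m ^ 3 * (1 / (real d)\<^sup>2)" for m d
    by (simp add: f_def norm_mult norm_divide norm_power)
  have "(\<lambda>p. norm (f p)) summable_on Sigma UNIV (\<lambda>_. UNIV)"
  proof (rule summable_on_SigmaI)
    show "((\<lambda>d. norm (f (m, d))) has_sum 1 / real m ^ 3 * infsum (\<lambda>d. 1 / (real d)\<^sup>2) UNIV) UNIV" for m
      unfolding norm_f using sq_on by (intro has_sum_cmult_right has_sum_infsum)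
    show "(\<lambda>m. 1 / real m ^ 3 * infsum (\<lambda>d. 1 / (real d)\<^sup>2) UNIV) summable_on UNIV"
      using cube_on by (rule summable_on_cmult_left)
  qed auto
  then have "f summable_on UNIV" by (simp add: abs_summable_summable)
  then obtain S where S: "(f has_sum S) (UNIV \<times> UNIV)" by (auto simp: summable_on_def)
  have "((\<lambda>m. of_real (1 / real m ^ 3) * circle_dilog (real m * x)) has_sum S) UNIV"
  proof (rule has_sum_SigmaD[OF S])
    fix m
    define z where "z = cis (2 * pi * (real m * x))"
    have z: "norm z \<le> 1" by (simp add: z_def)
    have "summable (\<lambda>d. norm (of_real (1 / (real d)\<^sup>2) * z ^ d))"
      using norm_dilog_term_le[OF z]
      by (intro summable_comparison_test'[OF summable_inverse_squares, of 0]) auto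
    moreover have "(\<lambda>d. of_real (1 / (real d)\<^sup>2) * z ^ d) sums circle_dilog (real m * x)"
      unfolding circle_dilog_def dilog_def z_def[symmetric]
      using summable_dilog[OF z] by (rule summable_sums)
    ultimately have "((\<lambda>d. of_real (1 / (real d)\<^sup>2) * z ^ d) has_sum circle_dilog (real m * x)) UNIV"
      by (rule norm_summable_imp_has_sum)
    then have "((\<lambda>d. of_real (1 / real m ^ 3) * (of_real (1 / (real d)\<^sup>2) * z ^ d)) has_sum
        of_real (1 / real m ^ 3) * circle_dilog (real m * x)) UNIV"
      by (rule has_sum_cmult_right)
    then show "((\<lambda>d. f (m, d)) has_sum of_real (1 / real m ^ 3) * circle_dilog (real m * x)) UNIV"
      by (simp add: f_def z_def Complex.DeMoivre mult_ac)
  qed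
  moreover have "((\<lambda>n. of_real (real (sigma1 n) / real n ^ 3) * cis (2 * pi * (real n * x))) has_sum S) {1..}"
  proof -
    \<comment> \<open>Terms with \<open>m = 0\<close> or \<open>d = 0\<close> vanish because
      division by zero gives 0.\<close>
    have "(f has_sum S) ({1..} \<times> {1..})"
      by (rule has_sum_cong_neutral[THEN iffD1, OF _ _ _ S]) (auto simp: f_def not_le)
    also have "({1..} \<times> {1..} :: (nat \<times> nat) set) = (\<lambda>(n, d). (n div d, d)) ` Sigma {1..} (\<lambda>n. {d. d dvd n})"
    proof (intro equalityI subsetI)
      fix p :: "nat \<times> nat" assume "p \<in> {1..} \<times> {1..}"
      then obtain m d where p: "p = (m, d)" "m \<ge> 1" "d \<ge> 1" by auto
      then show "p \<in> (\<lambda>(n, d). (n div d, d)) ` Sigma {1..} (\<lambda>n. {d. d dvd n})"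
        by (intro image_eqI[of _ _ "(m * d, d)"]) auto
    qed (auto simp: Suc_le_eq dvd_imp_le div_greater_zero_iff intro!: Nat.gr0I)
    finally have "((f \<circ> (\<lambda>(n, d). (n div d, d))) has_sum S) (Sigma {1..} (\<lambda>n. {d. d dvd n}))"
      by (subst (asm) has_sum_reindex) (auto simp: inj_on_def elim!: dvdE)
    then show ?thesis
    proof (rule has_sum_SigmaD)
      fix n :: nat assume n: "n \<in> {1..}"
      have "(f \<circ> (\<lambda>(n, d). (n div d, d))) (n, d) =
          of_real (real d / real n ^ 3) * cis (2 * pi * (real n * x))" if "d dvd n" for d
        using that n by (auto elim!: dvdE simp: f_def field_simps power2_eq_square power3_eq_cube)
      then have "(\<Sum>d | d dvd n. (f \<circ> (\<lambda>(n, d). (n div d, d))) (n, d)) =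
          (\<Sum>d | d dvd n. of_real (real d / real n ^ 3) * cis (2 * pi * (real n * x)))"
        by (intro sum.cong) auto
      also have "\<dots> = of_real (\<Sum>d | d dvd n. real d / real n ^ 3) * cis (2 * pi * (real n * x))"
        by (simp only: sum_distrib_right of_real_sum)
      also have "(\<Sum>d | d dvd n. real d / real n ^ 3) = real (sigma1 n) / real n ^ 3"
        by (simp add: sigma1_def sum_divide_distrib)
      finally show "((\<lambda>d. (f \<circ> (\<lambda>(n, d). (n div d, d))) (n, d)) has_sum
          of_real (real (sigma1 n) / real n ^ 3) * cis (2 * pi * (real n * x))) {d. d dvd n}"
        using n by (intro has_sum_finiteI) auto
    qed
  qed
  ultimately show ?thesis by blast
qed

lemma F2_G2_eq:
  "F2 x = (\<Sum>m. Im (circle_dilog (real (Suc m) * x)) / real (Suc m) ^ 3)"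
  "G2 x = (\<Sum>m. Re (circle_dilog (real (Suc m) * x)) / real (Suc m) ^ 3)"
proof -
  define A where "A m = of_real (1 / real m ^ 3) * circle_dilog (real m * x)" for m
  define E where "E n = of_real (real (sigma1 n) / real n ^ 3) * cis (2 * pi * (real n * x))" for n
  obtain S where S: "(A has_sum S) UNIV" "(E has_sum S) {1..}"
    unfolding A_def[abs_def] E_def[abs_def] using sigma1_series_has_sum by blast
  have "(E has_sum S) UNIV"
    by (rule has_sum_cong_neutral[THEN iffD1, OF _ _ _ S(2)]) (auto simp: E_def not_le)
  then have "(\<lambda>n. E (Suc n)) sums S" using has_sum_imp_sums sums_Suc_iff[of E S] by (simp add: E_def)
  moreover have "(\<lambda>n. A (Suc n)) sums S"
    using has_sum_imp_sums[OF S(1)] sums_Suc_iff[of A S] by (simp add: A_def)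
  ultimately have eq: "(\<Sum>n. Im (E (Suc n))) = (\<Sum>n. Im (A (Suc n)))"
      "(\<Sum>n. Re (E (Suc n))) = (\<Sum>n. Re (A (Suc n)))"
    by (simp_all add: sums_Im sums_Re flip: sums_unique[OF sums_Im] sums_unique[OF sums_Re])
  show "F2 x = (\<Sum>m. Im (circle_dilog (real (Suc m) * x)) / real (Suc m) ^ 3)"
    using eq(1) by (simp add: F2_def A_def E_def mult_ac del: of_nat_Suc)
  show "G2 x = (\<Sum>m. Re (circle_dilog (real (Suc m) * x)) / real (Suc m) ^ 3)"
    using eq(2) by (simp add: G2_def A_def E_def mult_ac del: of_nat_Suc)
qed

subsection \<open>Differentiating series of dilated functions\<close>

lemma summable_dilates:
  fixes \<phi> :: "real \<Rightarrow> real"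
  assumes "\<And>y. \<bar>\<phi> y\<bar> \<le> C"
  shows "summable (\<lambda>m. \<phi> (real (Suc m) * x) / real (Suc m) ^ 3)"
proof (rule summable_comparison_test'[where N = 0])
  have "summable (\<lambda>m. C * (1 / real m ^ 3))"
    using inverse_power_summable[of 3, where ?'a = real]
    by (intro summable_mult) (simp add: inverse_eq_divide)
  then show "summable (\<lambda>m. C * (1 / real (Suc m) ^ 3))"
    by (rule summable_Suc_iff[THEN iffD2])
  show "norm (\<phi> (real (Suc m) * x) / real (Suc m) ^ 3) \<le> C * (1 / real (Suc m) ^ 3)" for m
    using divide_right_mono[OF assms, of "real (Suc m) ^ 3"] by (simp del: of_nat_Suc)
qed

lemma dilates_quotient_sum:
  fixes \<phi> :: "real \<Rightarrow> real"
  assumes "\<And>y. \<bar>\<phi> y\<bar> \<le> C"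
  shows "(\<lambda>m. (\<phi> (real (Suc m) * y) / real (Suc m) ^ 3 - \<phi> (real (Suc m) * x) / real (Suc m) ^ 3) / h)
    sums (((\<Sum>m. \<phi> (real (Suc m) * y) / real (Suc m) ^ 3)
      - (\<Sum>m. \<phi> (real (Suc m) * x) / real (Suc m) ^ 3)) / h)"
  by (intro sums_divide sums_diff summable_sums summable_dilates[OF assms])

text \<open>The inner derivative contributes one factor \<open>Suc m\<close>, which turns the cube
  into a square.\<close>

lemma dilate_quotient_tendsto:
  fixes \<phi> :: "real \<Rightarrow> real"
  assumes "(\<phi> has_real_derivative D) (at (real (Suc m) * x))"
  shows "((\<lambda>h. (\<phi> (real (Suc m) * (x + h)) / real (Suc m) ^ 3 - \<phi> (real (Suc m) * x) / real (Suc m) ^ 3) / h)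
    \<longlongrightarrow> D / (real (Suc m))\<^sup>2) (at 0)"
proof -
  have "((\<lambda>y. \<phi> (real (Suc m) * y) / real (Suc m) ^ 3) has_real_derivative D / (real (Suc m))\<^sup>2) (at x)"
    using assms
    by (auto intro!: derivative_eq_intros DERIV_chain'[where g = \<phi>]
        simp: power2_eq_square power3_eq_cube simp del: of_nat_Suc)
  then show ?thesis by (simp only: DERIV_def)
qed

text \<open>The slope bound holds for every increment, so it dominates the difference quotients
  independently of \<open>h\<close>.\<close>

lemma has_derivative_series_of_dilates:
  fixes \<phi> :: "real \<Rightarrow> real"
  assumes bound: "\<And>y. \<bar>\<phi> y\<bar> \<le> C"
    and deriv: "\<And>m. (\<phi> has_real_derivative D m) (at (real (Suc m) * x))"
    and slope: "\<And>m u. \<bar>\<phi> (real (Suc m) * x + u) - \<phi> (real (Suc m) * x)\<bar> \<le> B m * \<bar>u\<bar>"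
    and sum: "summable (\<lambda>m. B m / (real (Suc m))\<^sup>2)"
  shows "((\<lambda>x. \<Sum>m. \<phi> (real (Suc m) * x) / real (Suc m) ^ 3) has_real_derivative
    (\<Sum>m. D m / (real (Suc m))\<^sup>2)) (at x)"
proof -
  define q where "q m h = (\<phi> (real (Suc m) * (x + h)) / real (Suc m) ^ 3
      - \<phi> (real (Suc m) * x) / real (Suc m) ^ 3) / h" for m h
  have "norm (q m h) \<le> B m / (real (Suc m))\<^sup>2" if "h \<noteq> 0" for m h
  proof -
    have "norm (q m h) = \<bar>\<phi> (real (Suc m) * x + real (Suc m) * h) - \<phi> (real (Suc m) * x)\<bar> /
        (real (Suc m) ^ 3 * \<bar>h\<bar>)"
      by (simp add: q_def distrib_left abs_mult del: of_nat_Suc flip: diff_divide_distrib)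
    also have "\<dots> \<le> B m * \<bar>real (Suc m) * h\<bar> / (real (Suc m) ^ 3 * \<bar>h\<bar>)"
      by (intro divide_right_mono slope) auto
    also have "\<dots> = B m / (real (Suc m))\<^sup>2"
      using that by (simp add: abs_mult power2_eq_square power3_eq_cube del: of_nat_Suc)
    finally show ?thesis .
  qed
  then have "\<forall>\<^sub>F h in at 0. \<forall>m. norm (q m h) \<le> B m / (real (Suc m))\<^sup>2"
    by (auto simp: eventually_at intro!: exI[of _ 1])
  \<comment> \<open>Tannery's theorem asks for the bound along a product filter; here it holds for
    all \<open>m\<close> at once.\<close>
  then have "\<forall>\<^sub>F (m, h) in at_top \<times>\<^sub>F at 0. norm (q m h) \<le> B m / (real (Suc m))\<^sup>2"
    unfolding eventually_prod_filter
    by (intro exI[of _ "\<lambda>_. True"] exI[of _ "\<lambda>h. \<forall>m. norm (q m h) \<le> B m / (real (Suc m))\<^sup>2"]) auto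
  then have "((\<lambda>h. \<Sum>m. q m h) \<longlongrightarrow> (\<Sum>m. D m / (real (Suc m))\<^sup>2)) (at 0)"
    using tannerys_theorem[OF dilate_quotient_tendsto[OF deriv] _ sum] by (simp add: q_def)
  moreover have "(\<Sum>m. q m h) = ((\<Sum>m. \<phi> (real (Suc m) * (x + h)) / real (Suc m) ^ 3)
      - (\<Sum>m. \<phi> (real (Suc m) * x) / real (Suc m) ^ 3)) / h" for h
    unfolding q_def by (rule sums_unique[OF dilates_quotient_sum[OF bound], symmetric])
  ultimately show ?thesis by (simp add: DERIV_def)
qed

text \<open>The converse to dominated differentiation is Fatou's lemma for the difference quotients.\<close>
lemma summable_derivatives_of_dilates:
  fixes \<phi> :: "real \<Rightarrow> real"
  assumes bound: "\<And>y. \<bar>\<phi> y\<bar> \<le> C"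
    and deriv: "\<And>m. (\<phi> has_real_derivative D m) (at (real (Suc m) * x))"
    and slope: "\<And>a b. a \<le> b \<Longrightarrow> - c * (b - a) \<le> \<phi> b - \<phi> a"
    and diff: "(\<lambda>x. \<Sum>m. \<phi> (real (Suc m) * x) / real (Suc m) ^ 3) differentiable (at x)"
  shows "summable (\<lambda>m. D m / (real (Suc m))\<^sup>2)"
proof -
  define V where "V = (\<lambda>x. \<Sum>m. \<phi> (real (Suc m) * x) / real (Suc m) ^ 3)"
  obtain V' where "(V has_real_derivative V') (at x)"
    using diff by (auto simp: V_def real_differentiable_def)
  then have V': "((\<lambda>h. (V (x + h) - V x) / h) \<longlongrightarrow> V') (at 0)" by (simp add: DERIV_def)
  define q where "q m h = (\<phi> (real (Suc m) * (x + h)) / real (Suc m) ^ 3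
      - \<phi> (real (Suc m) * x) / real (Suc m) ^ 3) / h" for m h
  \<comment> \<open>Adding \<open>k m\<close> makes the quotients for positive \<open>h\<close>
    nonnegative.\<close>
  define k where "k m = c * (1 / (real (Suc m))\<^sup>2)" for m
  have k: "summable k"
    unfolding k_def[abs_def]
    by (rule summable_mult[OF summable_inverse_squares_Suc])
  have q_sum: "summable (\<lambda>m. q m h)" and V_q: "(V (x + h) - V x) / h = (\<Sum>m. q m h)" for h
    unfolding q_def V_def
    by (rule sums_summable[OF dilates_quotient_sum[OF bound]],
        rule sums_unique[OF dilates_quotient_sum[OF bound]])
  have q_lim: "(q m \<longlongrightarrow> D m / (real (Suc m))\<^sup>2) (at_right 0)" for m
    using dilate_quotient_tendsto[OF deriv[of m]]
    unfolding q_def[abs_def] by (rule tendsto_within_subset) auto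
  have q_ge: "0 \<le> q m h + k m" if "h > 0" for m h
  proof -
    have "- c * (real (Suc m) * (x + h) - real (Suc m) * x)
        \<le> \<phi> (real (Suc m) * (x + h)) - \<phi> (real (Suc m) * x)"
      using that by (intro slope mult_left_mono) auto
    then have "- c * (real (Suc m) * h) / (real (Suc m) ^ 3 * h)
        \<le> (\<phi> (real (Suc m) * (x + h)) - \<phi> (real (Suc m) * x)) / (real (Suc m) ^ 3 * h)"
      using that by (intro divide_right_mono) (auto simp: distrib_left simp del: of_nat_Suc)
    also have "\<dots> = q m h" by (simp add: q_def del: of_nat_Suc flip: diff_divide_distrib)
    also have "- c * (real (Suc m) * h) / (real (Suc m) ^ 3 * h) = - k m"
      using that by (simp add: k_def power2_eq_square power3_eq_cube del: of_nat_Suc)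
    finally show ?thesis by simp
  qed
  have ev: "\<forall>\<^sub>F h in at_right (0::real). h > 0" by (simp add: eventually_at_right_less)
  have "summable (\<lambda>m. D m / (real (Suc m))\<^sup>2 + k m)"
  proof (rule summableI_nonneg_bounded)
    show "0 \<le> D m / (real (Suc m))\<^sup>2 + k m" for m
      using eventually_mono[OF ev q_ge]
      by (intro tendsto_lowerbound[OF tendsto_add[OF q_lim tendsto_const]]) auto
    \<comment> \<open>Nonnegativity bounds a partial sum by the full difference quotient before
      \<open>h\<close> tends to 0.\<close>
    fix M
    show "(\<Sum>m<M. D m / (real (Suc m))\<^sup>2 + k m) \<le> V' + suminf k"
    proof (rule tendsto_le)
      show "((\<lambda>h. (V (x + h) - V x) / h + suminf k) \<longlongrightarrow> V' + suminf k) (at_right 0)"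
        by (intro tendsto_intros tendsto_within_subset[OF V']) auto
      show "((\<lambda>h. \<Sum>m<M. q m h + k m) \<longlongrightarrow> (\<Sum>m<M. D m / (real (Suc m))\<^sup>2 + k m)) (at_right 0)"
        by (intro tendsto_intros q_lim)
      show "\<forall>\<^sub>F h in at_right 0. (\<Sum>m<M. q m h + k m) \<le> (V (x + h) - V x) / h + suminf k"
        using ev
      proof eventually_elim
        case (elim h)
        have "(\<Sum>m<M. q m h + k m) \<le> (\<Sum>m. q m h + k m)"
          using elim q_ge k q_sum by (intro sum_le_suminf summable_add) auto
        also have "\<dots> = (V (x + h) - V x) / h + suminf k"
          using k q_sum by (simp add: V_q suminf_add)
        finally show ?case .
      qed
    qed simp
  qed
  then have "summable (\<lambda>m. D m / (real (Suc m))\<^sup>2 + k m - k m)" using k by (rule summable_diff)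
  then show ?thesis by simp
qed

section \<open>Differentiability of \<open>F2\<close> and \<open>G2\<close> at irrational
  points\<close>

lemma circle_dilog_real_derivatives:
  assumes "y \<notin> \<int>"
  shows "((\<lambda>t. Im (circle_dilog t)) has_real_derivative - (2 * pi * ln (norm (1 - cis (2 * pi * y))))) (at y)"
    and "((\<lambda>t. Re (circle_dilog t)) has_real_derivative 2 * pi * Im (Ln (1 - cis (2 * pi * y)))) (at y)"
proof -
  define w where "w = 1 - cis (2 * pi * y)"
  have "w \<noteq> 0"
    using norm_1_minus_cis_ge[of y] int_dist_pos[OF assms] unfolding w_def by fastforce
  have d: "(circle_dilog has_vector_derivative - (2 * pi * \<i>) * Ln w) (at y)"
    unfolding w_def by (rule circle_dilog_has_vector_derivative[OF assms])
  show "((\<lambda>t. Im (circle_dilog t)) has_real_derivative - (2 * pi * ln (norm (1 - cis (2 * pi * y))))) (at y)"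
    using bounded_linear.has_vector_derivative[OF bounded_linear_Im d] \<open>w \<noteq> 0\<close>
    unfolding has_real_derivative_iff_has_vector_derivative w_def[symmetric] by (simp add: Re_Ln)
  show "((\<lambda>t. Re (circle_dilog t)) has_real_derivative 2 * pi * Im (Ln (1 - cis (2 * pi * y)))) (at y)"
    using bounded_linear.has_vector_derivative[OF bounded_linear_Re d]
    unfolding has_real_derivative_iff_has_vector_derivative w_def[symmetric] by simp
qed

lemma G2_differentiable:
  assumes "x \<notin> \<rat>"
  shows "G2 differentiable (at x)"
proof -
  have y: "real (Suc m) * x \<notin> \<int>" for m
    using of_nat_mult_irrational[OF assms, of "Suc m"] by simp
  have "summable (\<lambda>m. pi\<^sup>2 * (1 / (real (Suc m))\<^sup>2))"
    by (rule summable_mult[OF summable_inverse_squares_Suc])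
  then have "((\<lambda>x. \<Sum>m. Re (circle_dilog (real (Suc m) * x)) / real (Suc m) ^ 3) has_real_derivative
      (\<Sum>m. 2 * pi * Im (Ln (1 - cis (2 * pi * (real (Suc m) * x)))) / (real (Suc m))\<^sup>2)) (at x)"
    using order_trans[OF abs_Re_le_cmod norm_circle_dilog_le] circle_dilog_real_derivatives(2)[OF y]
      Re_circle_dilog_lipschitz
    by (intro has_derivative_series_of_dilates[where B = "\<lambda>_. pi\<^sup>2"])
       (auto simp: abs_minus_commute simp del: of_nat_Suc intro: order_trans[OF Re_circle_dilog_lipschitz])
  then show ?thesis unfolding F2_G2_eq(2)[abs_def] real_differentiable_def by blast
qed

text \<open>One direction dominates the quotients by the logarithmic distances. The other extracts
  summable derivatives and compares them with these distances.\<close>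

lemma F2_differentiable_iff:
  assumes "x \<notin> \<rat>"
  shows "F2 differentiable (at x) \<longleftrightarrow> square_brjuno x"
proof
  define y where "y m = real (Suc m) * x" for m
  define D where "D m = - (2 * pi * ln (norm (1 - cis (2 * pi * y m))))" for m
  have y: "y m \<notin> \<int>" for m
    unfolding y_def using of_nat_mult_irrational[OF assms, of "Suc m"] by simp
  have bound: "\<bar>Im (circle_dilog t)\<bar> \<le> (\<Sum>n. 1 / (real n)\<^sup>2)" for t
    by (rule order_trans[OF abs_Im_le_cmod norm_circle_dilog_le])
  have deriv: "((\<lambda>t. Im (circle_dilog t)) has_real_derivative D m) (at (real (Suc m) * x))" for m
    using circle_dilog_real_derivatives(1)[OF y[of m]] by (simp only: D_def y_def)
  {
    define K where "K = 2 * pi + 2 + 2 * pi * ln 4 + pi\<^sup>2"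
    assume "square_brjuno x"
    then have "summable (\<lambda>m. - ln (int_dist (y m)) / (real (Suc m))\<^sup>2)"
      unfolding y_def by (rule summable_if_square_brjuno)
    then have "summable (\<lambda>m. K * (1 / (real (Suc m))\<^sup>2) + 2 * pi * (- ln (int_dist (y m)) / (real (Suc m))\<^sup>2))"
      by (intro summable_add summable_mult[OF summable_inverse_squares_Suc] summable_mult)
    then have "summable (\<lambda>m. (K - 2 * pi * ln (int_dist (y m))) / (real (Suc m))\<^sup>2)"
      by (simp add: diff_divide_distrib)
    moreover have "\<bar>Im (circle_dilog (y m + u)) - Im (circle_dilog (y m))\<bar>
        \<le> (K - 2 * pi * ln (int_dist (y m))) * \<bar>u\<bar>" for m u
      using order_trans[OF abs_Im_le_cmod circle_dilog_slope_le[OF y], of m u] by (simp add: K_def)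
    ultimately have "((\<lambda>x. \<Sum>m. Im (circle_dilog (real (Suc m) * x)) / real (Suc m) ^ 3)
        has_real_derivative (\<Sum>m. D m / (real (Suc m))\<^sup>2)) (at x)"
      unfolding y_def
      by (rule has_derivative_series_of_dilates[where \<phi> = "\<lambda>t. Im (circle_dilog t)",
            OF bound deriv, rotated])
    then show "F2 differentiable (at x)"
      unfolding F2_G2_eq(1)[abs_def] real_differentiable_def by blast
  }
  assume "F2 differentiable (at x)"
  then have "summable (\<lambda>m. D m / (real (Suc m))\<^sup>2)"
    unfolding F2_G2_eq(1)[abs_def]
    by (rule summable_derivatives_of_dilates[OF bound deriv, where c = "2 * pi * ln 2", rotated])
       (rule Im_circle_dilog_slope_ge)
  \<comment> \<open>The chord is at most \<open>2 * pi\<close> times the distance to the integers,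
    which accounts for the extra \<open>ln (2 * pi)\<close>.\<close>
  then have "summable (\<lambda>m. 1 / (2 * pi) * (D m / (real (Suc m))\<^sup>2) + ln (2 * pi) * (1 / (real (Suc m))\<^sup>2))"
    by (intro summable_add summable_mult summable_inverse_squares_Suc)
  moreover have "norm (- ln (int_dist (y m)) / (real (Suc m))\<^sup>2) \<le>
      1 / (2 * pi) * (D m / (real (Suc m))\<^sup>2) + ln (2 * pi) * (1 / (real (Suc m))\<^sup>2)" for m
  proof -
    have "0 < int_dist (y m)" by (rule int_dist_pos[OF y])
    moreover from this have "0 < norm (1 - cis (2 * pi * y m))"
      using norm_1_minus_cis_ge[of "y m"] by linarith
    ultimately have "ln (norm (1 - cis (2 * pi * y m))) \<le> ln (2 * pi * int_dist (y m))"
      using norm_1_minus_cis_le[of "y m"] by (intro ln_mono) auto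
    also have "\<dots> = ln (2 * pi) + ln (int_dist (y m))"
      using \<open>0 < int_dist (y m)\<close> by (simp add: ln_mult)
    finally have "- ln (int_dist (y m)) \<le> 1 / (2 * pi) * D m + ln (2 * pi)" by (simp add: D_def)
    then have "- ln (int_dist (y m)) / (real (Suc m))\<^sup>2 \<le> (1 / (2 * pi) * D m + ln (2 * pi)) / (real (Suc m))\<^sup>2"
      by (rule divide_right_mono) simp
    then show ?thesis
      using neg_ln_int_dist_nonneg[of "y m"] by (simp add: add_divide_distrib del: of_nat_Suc)
  qed
  ultimately have "summable (\<lambda>m. - ln (int_dist (y m)) / (real (Suc m))\<^sup>2)"
    by (rule summable_comparison_test')
  then show "square_brjuno x"
    unfolding y_def by (rule square_brjuno_if_summable[OF assms])
qed

theorem theorem1p3: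
  fixes x :: real
  assumes "x \<notin> \<rat>"
  shows "(square_brjuno x \<and> (cond_star x \<or> cond_star_star x) \<longrightarrow> F2 differentiable (at x)) \<and>
         (\<not> square_brjuno x \<longrightarrow> \<not> F2 differentiable (at x)) \<and>
         (cond_star x \<or> cond_star_star x \<longrightarrow> G2 differentiable (at x))"
  using F2_differentiable_iff[OF assms] G2_differentiable[OF assms] by blast

end
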